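(* Let $G$ be a planar graph of order $n\ge 3$. Then $\mathrm{id}^{\leq 3}(G)\leq \frac{11}{6}n-\frac{8}{3}$ and $\mathrm{id}^{\leq 5}(G)\le \mathrm{id}^{\leq 4}(G)\leq \frac{4}{3}n+\frac{10}{3}$.
   Context: All graphs are finite and simple. For an oriented graph $D$ and a set $X\subseteq V(D)$, the inversion of $X$ reverses the orientation of every arc with both endvertices in $X$. For an integer $p\ge 2$, a $(\leq p)$-inversion is the inversion of a set of at most $p$ vertices. For a graph $G$, $\mathrm{id}^{\leq p}(G)$ (the $(\leq p)$-inversion diameter) is the maximum, over all ordered pairs $(\vec G_1,\vec G_2)$ of orientations of $G$ (on the same labelled vertex set), of the minimum number of $(\leq p)$-inversions whose successive application transforms $\vec G_1$ into $\vec G_2$. *)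

theory Defs
  imports "HOL-Analysis.Analysis"
begin

definition simple_graph :: "'a set \<Rightarrow> 'a set set \<Rightarrow> bool" where
  "simple_graph V E \<longleftrightarrow> finite V \<and>
     (\<forall>e\<in>E. \<exists>u v. u \<noteq> v \<and> u \<in> V \<and> v \<in> V \<and> e = {u, v})"

definition planar :: "'a set \<Rightarrow> 'a set set \<Rightarrow> bool" where
  "planar V E \<longleftrightarrow> (\<exists>(f :: 'a \<Rightarrow> complex) (\<gamma> :: 'a set \<Rightarrow> real \<Rightarrow> complex).
     inj_on f V \<and>
     (\<forall>e\<in>E. arc (\<gamma> e) \<and> {pathstart (\<gamma> e), pathfinish (\<gamma> e)} = f ` e) \<and>
     (\<forall>e\<in>E. \<forall>v\<in>V. f v \<in> path_image (\<gamma> e) \<longrightarrow> v \<in> e) \<and>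
     (\<forall>e\<in>E. \<forall>e'\<in>E. e \<noteq> e' \<longrightarrow> path_image (\<gamma> e) \<inter> path_image (\<gamma> e') \<subseteq> f ` (e \<inter> e')))"

definition is_orientation :: "'a set \<Rightarrow> 'a set set \<Rightarrow> ('a \<times> 'a) set \<Rightarrow> bool" where
  "is_orientation V E A \<longleftrightarrow> A \<subseteq> V \<times> V \<and> (\<forall>(u, v)\<in>A. {u, v} \<in> E) \<and>
     (\<forall>u v. {u, v} \<in> E \<longrightarrow> ((u, v) \<in> A \<longleftrightarrow> (v, u) \<notin> A))"

definition invert :: "'a set \<Rightarrow> ('a \<times> 'a) set \<Rightarrow> ('a \<times> 'a) set" where
  "invert X A = {(u, v). ((u, v) \<in> A \<and> \<not> (u \<in> X \<and> v \<in> X)) \<or> ((v, u) \<in> A \<and> u \<in> X \<and> v \<in> X)}"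

definition inv_dist :: "nat \<Rightarrow> 'a set \<Rightarrow> ('a \<times> 'a) set \<Rightarrow> ('a \<times> 'a) set \<Rightarrow> nat" where
  "inv_dist p V A B = (LEAST k. \<exists>Xs. length Xs = k \<and>
      (\<forall>X\<in>set Xs. X \<subseteq> V \<and> finite X \<and> card X \<le> p) \<and> fold invert Xs A = B)"

definition inv_diam :: "nat \<Rightarrow> 'a set \<Rightarrow> 'a set set \<Rightarrow> nat" where
  "inv_diam p V E = Max {inv_dist p V A B | A B. is_orientation V E A \<and> is_orientation V E B}"

end

theory Submission
  imports Defs
begin

text \<open>
  Inversions commute, so transforming one orientation into another means choosing vertex sets
  such that every edge lies in an odd number of them exactly if it belongs to the set \<open>T\<close> of edges
  to be reversed. Let \<open>q = p - 1\<close>. Delete the vertices one at a time, repairing all edges at the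
  deleted vertex \<open>v\<close> by sets that consist of \<open>v\<close> and \<open>q\<close> of its neighbours; the effect on the
  remaining edges is absorbed into \<open>T\<close>. Rounding is too expensive only if the degree of \<open>v\<close> is
  \<open>1\<close> modulo \<open>q\<close> and all edges at \<open>v\<close> lie in \<open>T\<close>. Then one set has \<open>q - 1\<close> places left, and
  these suffice to make a neighbour of \<open>v\<close>, deleted next, cheap enough to compensate. For
  \<open>q = 2, 3\<close> and any graph with \<open>n\<close> vertices and \<open>m\<close> edges this needs at most
  \<open>m / q + (q - 1) n / (2 q)\<close> inversions.

  For planar graphs \<open>m \<le> 3 n - 5\<close> suffices. Its proof avoids faces: if \<open>C\<close> is a cycle of length \<open>k\<close>
  with \<open>i\<close> vertices inside, then at most \<open>3 i + k - 3\<close> edges lie inside \<open>C\<close>. If a path inside joins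
  two vertices of \<open>C\<close>, the theta curve theorem splits the inside and the two bounds add up;
  otherwise every component of the graph inside is attached to at most one vertex of \<open>C\<close> and can
  be removed. The inversion \<open>z \<mapsto> 1 / (z - p)\<close> at a point \<open>p\<close> inside \<open>C\<close> gives the same bound outside.
\<close>

section \<open>Inversion distance of arbitrary graphs\<close>

definition hits :: "'a set list \<Rightarrow> 'a set \<Rightarrow> nat" where
  "hits Xs e = length (filter (\<lambda>X. e \<subseteq> X) Xs)"

lemma hits_simps [simp]:
  "hits [] e = 0"
  "hits (X # Xs) e = (if e \<subseteq> X then Suc (hits Xs e) else hits Xs e)"
  "hits (Xs @ Ys) e = hits Xs e + hits Ys e"
  by (auto simp: hits_def)

lemma hits_eq_0: "(\<And>X. X \<in> set Xs \<Longrightarrow> \<not> e \<subseteq> X) \<Longrightarrow> hits Xs e = 0"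
  by (auto simp: hits_def filter_empty_conv)

text \<open>\<open>T\<close> is an arbitrary collection of sets that is read only on
  \<open>E\<close>. After some inversions it can therefore be replaced by a parity condition ranging
  over all sets.\<close>

definition solves :: "nat \<Rightarrow> 'a set \<Rightarrow> 'a set set \<Rightarrow> 'a set set \<Rightarrow> 'a set list \<Rightarrow> bool" where
  "solves p V E T Xs \<longleftrightarrow> (\<forall>X\<in>set Xs. X \<subseteq> V \<and> finite X \<and> card X \<le> p) \<and>
     (\<forall>e\<in>E. odd (hits Xs e) \<longleftrightarrow> e \<in> T)"

text \<open>An inversion exchanges the roles of \<open>(u, v)\<close> and \<open>(v, u)\<close>
  exactly if both ends lie in the set, and two exchanges cancel. So only the parity of the number of
  covering sets matters, not their order.\<close>

lemma fold_invert:
  "fold invert Xs A = {(u, v). if odd (hits Xs {u, v}) then (v, u) \<in> A else (u, v) \<in> A}"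
proof (induction Xs arbitrary: A)
  case (Cons X Xs)
  have inv: "(u, v) \<in> invert X A \<longleftrightarrow> (if u \<in> X \<and> v \<in> X then (v, u) \<in> A else (u, v) \<in> A)" for u v
    by (auto simp: invert_def)
  have "fold invert (X # Xs) A = fold invert Xs (invert X A)" by simp
  also have "\<dots> = {(u, v). if odd (hits (X # Xs) {u, v}) then (v, u) \<in> A else (u, v) \<in> A}"
    unfolding Cons.IH by (auto simp: inv conj_commute)
  finally show ?case .
qed auto

text \<open>On an edge each orientation picks exactly one direction, so the edge has to be reversed
  exactly if its arc in \<open>A\<close> is missing from \<open>B\<close>. Pairs that are no edges
  carry no arc at all.\<close>

lemma fold_invert_solves:
  assumes A: "is_orientation V E A" and B: "is_orientation V E B"
    and "solves p V E {{u, v} | u v. (u, v) \<in> A - B} Xs"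
  shows "fold invert Xs A = B"
proof -
  have *: "odd (hits Xs {u, v}) \<longleftrightarrow> ((u, v) \<in> A - B \<or> (v, u) \<in> A - B)" if "{u, v} \<in> E" for u v
  proof -
    have "{u, v} \<in> {{u, v} | u v. (u, v) \<in> A - B} \<longleftrightarrow> (u, v) \<in> A - B \<or> (v, u) \<in> A - B"
      (is "?L \<longleftrightarrow> ?R")
    proof
      assume ?L
      then obtain x y where "{u, v} = {x, y}" "(x, y) \<in> A - B" by blast
      then show ?R by (metis doubleton_eq_iff)
    next
      assume ?R
      then show ?L unfolding mem_Collect_eq using insert_commute[of u v "{}"] by metis
    qed
    then show ?thesis using assms(3) that by (simp only: solves_def)
  qed
  have EA: "\<And>x y. (x, y) \<in> A \<Longrightarrow> {x, y} \<in> E" and EB: "\<And>x y. (x, y) \<in> B \<Longrightarrow> {x, y} \<in> E"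
    using A B unfolding is_orientation_def by fast+
  have A': "\<And>u v. {u, v} \<in> E \<Longrightarrow> (u, v) \<in> A \<longleftrightarrow> (v, u) \<notin> A"
    using A unfolding is_orientation_def by meson
  have B': "\<And>u v. {u, v} \<in> E \<Longrightarrow> (u, v) \<in> B \<longleftrightarrow> (v, u) \<notin> B"
    using B unfolding is_orientation_def by meson
  have "(if odd (hits Xs {u, v}) then (v, u) \<in> A else (u, v) \<in> A) \<longleftrightarrow> (u, v) \<in> B" for u v
  proof (cases "{u, v} \<in> E")
    case True
    then show ?thesis using *[OF True] A'[OF True] B'[OF True]
      by (cases "(u, v) \<in> A"; cases "(u, v) \<in> B") simp_all
  next
    case False
    then have "(u, v) \<notin> A" "(v, u) \<notin> A" "(u, v) \<notin> B"
      using EA EB[of u v] insert_commute[of u v "{}"] by metis+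
    then show ?thesis by simp
  qed
  then show ?thesis unfolding fold_invert by simp
qed

text \<open>Greedy: cut off \<open>min q (card S)\<close> elements at a time. Blocks may be empty,
  so that their number can be exactly \<open>k\<close>.\<close>

lemma blocks_exist:
  assumes "finite S" "card S \<le> k * q"
  shows "\<exists>Bs. length Bs = k \<and> (\<forall>B\<in>set Bs. B \<subseteq> S \<and> card B \<le> q) \<and>
           (\<forall>x\<in>S. length (filter (\<lambda>B. x \<in> B) Bs) = 1)"
  using assms
proof (induction k arbitrary: S)
  case 0
  then show ?case by auto
next
  case (Suc k)
  obtain B where B: "B \<subseteq> S" "card B = min q (card S)"
    by (meson min.cobounded2 obtain_subset_with_card_n)
  have "card (S - B) = card S - card B"
    using B Suc.prems by (simp add: card_Diff_subset finite_subset)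
  then have "card (S - B) \<le> k * q" using B Suc.prems by auto
  from Suc.IH[OF _ this] Suc.prems obtain Bs where Bs: "length Bs = k"
    "\<forall>B'\<in>set Bs. B' \<subseteq> S - B \<and> card B' \<le> q"
    "\<forall>x\<in>S - B. length (filter (\<lambda>B. x \<in> B) Bs) = 1" by auto
  have "length (filter (\<lambda>B. x \<in> B) Bs) = 0" if "x \<in> B" for x
    using Bs(2) that by (auto simp: filter_empty_conv)
  then have "\<forall>x\<in>S. length (filter (\<lambda>B. x \<in> B) (B # Bs)) = 1" using Bs(3) by auto
  moreover have "\<forall>B'\<in>set (B # Bs). B' \<subseteq> S \<and> card B' \<le> q" using B Bs(2) by auto
  ultimately show ?case using Bs(1) by (intro exI[of _ "B # Bs"]) auto
qed

section \<open>Neighbourhoods and deletion of a vertex\<close>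

definition nbrs :: "'a set set \<Rightarrow> 'a \<Rightarrow> 'a set" where
  "nbrs E v = {u. {v, u} \<in> E}"

lemma simple_graph_finite_edges: "simple_graph V E \<Longrightarrow> finite E"
  unfolding simple_graph_def by (rule finite_subset[of _ "Pow V"]) auto

lemma simple_graph_singleton: "simple_graph V E \<Longrightarrow> {v} \<notin> E"
  unfolding simple_graph_def by (metis doubleton_eq_iff insert_absorb2)

lemma nbrs_subset: "simple_graph V E \<Longrightarrow> nbrs E v \<subseteq> V - {v}"
  using simple_graph_singleton[of V E v]
  unfolding simple_graph_def nbrs_def by (force simp: doubleton_eq_iff)

lemma simple_graph_delete:
  "simple_graph V E \<Longrightarrow> simple_graph (V - {v}) {e \<in> E. v \<notin> e}"
  unfolding simple_graph_def by fastforce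

lemma card_edges_delete:
  assumes "simple_graph V E"
  shows "card E = card {e \<in> E. v \<notin> e} + card (nbrs E v)"
proof -
  have "{e \<in> E. v \<in> e} = (\<lambda>u. {v, u}) ` nbrs E v"
    using assms unfolding simple_graph_def nbrs_def by (fastforce simp: insert_commute)
  moreover have "inj_on (\<lambda>u. {v, u}) (nbrs E v)"
    by (auto simp: inj_on_def doubleton_eq_iff)
  ultimately have "card {e \<in> E. v \<in> e} = card (nbrs E v)" by (simp add: card_image)
  moreover have "card E = card {e \<in> E. v \<notin> e} + card {e \<in> E. v \<in> e}"
    using simple_graph_finite_edges[OF assms]
    by (subst card_Un_disjoint[symmetric]) (auto intro!: arg_cong[where f = card])
  ultimately show ?thesis by simp
qed

text \<open>The sets in \<open>Xs\<close> avoid \<open>v\<close> and leave its edges as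
  \<open>Ys\<close> made them. What \<open>Ys\<close> does to the other edges is corrected through
  the modified target set.\<close>

lemma solves_delete:
  assumes G: "simple_graph V E"
    and Ys: "\<forall>X\<in>set Ys. X \<subseteq> V \<and> finite X \<and> card X \<le> p"
      "\<And>u. u \<in> nbrs E v \<Longrightarrow> odd (hits Ys {v, u}) \<longleftrightarrow> {v, u} \<in> T"
    and Xs: "solves p (V - {v}) {e \<in> E. v \<notin> e} {e. e \<in> T \<longleftrightarrow> even (hits Ys e)} Xs"
  shows "solves p V E T (Ys @ Xs)"
proof -
  have "odd (hits (Ys @ Xs) e) \<longleftrightarrow> e \<in> T" if e: "e \<in> E" for e
  proof (cases "v \<in> e")
    case True
    then obtain u where u: "e = {v, u}" "u \<in> nbrs E v"
      using G e unfolding simple_graph_def nbrs_def by (fastforce simp: insert_commute)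
    have "hits Xs e = 0" using Xs True by (intro hits_eq_0) (auto simp: solves_def)
    then show ?thesis using Ys(2)[OF u(2)] u by simp
  next
    case False
    then show ?thesis using Xs e by (auto simp: solves_def)
  qed
  then show ?thesis using Ys(1) Xs by (auto simp: solves_def)
qed

text \<open>Partition \<open>S\<close> into blocks of size at most \<open>q\<close> and add the
  centre \<open>v\<close> to each of them.\<close>

lemma star_blocks:
  assumes "finite S" "card S \<le> k * q" "v \<notin> S"
  shows "\<exists>Ys. length Ys = k \<and> (\<forall>X\<in>set Ys. X \<subseteq> insert v S \<and> finite X \<and> card X \<le> Suc q) \<and>
           (\<forall>u. u \<noteq> v \<longrightarrow> hits Ys {v, u} = (if u \<in> S then 1 else 0))"
proof -
  from blocks_exist[OF assms(1,2)] obtain Bs where Bs: "length Bs = k"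
    "\<forall>B\<in>set Bs. B \<subseteq> S \<and> card B \<le> q" "\<forall>x\<in>S. length (filter (\<lambda>B. x \<in> B) Bs) = 1" by blast
  have eq: "hits (map (insert v) Bs) {v, u} = length (filter (\<lambda>B. u \<in> B) Bs)" if "u \<noteq> v" for u
    using that by (induction Bs) auto
  have "length (filter (\<lambda>B. u \<in> B) Bs) = 0" if "u \<notin> S" for u
    using Bs(2) that by (auto simp: filter_empty_conv)
  then have "\<forall>u. u \<noteq> v \<longrightarrow> hits (map (insert v) Bs) {v, u} = (if u \<in> S then 1 else 0)"
    using eq Bs(3) by auto
  moreover have "\<forall>X\<in>set (map (insert v) Bs). X \<subseteq> insert v S \<and> finite X \<and> card X \<le> Suc q"
    using Bs(2) assms(1) by (auto simp: finite_subset card_insert_if le_SucI)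
  ultimately show ?thesis using Bs(1) by (intro exI[of _ "map (insert v) Bs"]) auto
qed

text \<open>Take for \<open>k\<close> the quotient t/q rounded up. If t has residue 1, rounding
  costs 2(q-1) on the left; then t < d contributes 2 on the right, and 2(q-1) \<le> 2 + (q-1) for q
  \<le> 3. For the other residues the cost is at most 2(q-2) \<le> q-1.\<close>

lemma block_count_exists:
  fixes q t d :: nat
  assumes "q = 2 \<or> q = 3" "t \<le> d" "\<not> (t = d \<and> d mod q = 1)"
  shows "\<exists>k. t \<le> k * q \<and> 2 * q * k \<le> 2 * d + (q - 1)"
  using assms(1)
proof
  assume [simp]: "q = 2"
  have "\<exists>i. t = 2 * i \<or> t = 2 * i + 1" by presburger
  then obtain i where "t = 2 * i \<or> t = 2 * i + 1" ..
  then show ?thesis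
  proof
    assume "t = 2 * i"
    then show ?thesis using assms(2) by (intro exI[of _ i]) simp
  next
    assume t: "t = 2 * i + 1"
    then have "t \<noteq> d" using assms(3) by auto
    then show ?thesis using assms(2) t by (intro exI[of _ "i + 1"]) simp
  qed
next
  assume [simp]: "q = 3"
  have "\<exists>i. t = 3 * i \<or> t = 3 * i + 1 \<or> t = 3 * i + 2" by presburger
  then obtain i where "t = 3 * i \<or> t = 3 * i + 1 \<or> t = 3 * i + 2" ..
  then show ?thesis
  proof (elim disjE)
    assume "t = 3 * i"
    then show ?thesis using assms(2) by (intro exI[of _ i]) simp
  next
    assume t: "t = 3 * i + 1"
    then have "t \<noteq> d" using assms(3) by auto
    then show ?thesis using assms(2) t by (intro exI[of _ "i + 1"]) simp
  next
    assume "t = 3 * i + 2"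
    then show ?thesis using assms(2) by (intro exI[of _ "i + 1"]) simp
  qed
qed

text \<open>Strong induction on the number of vertices, since a step deletes one vertex or two;
  \<open>T\<close> varies because each step changes it. With denominators cleared, a vertex that has
  degree d when it is deleted brings a budget of 2d + (q-1).\<close>

lemma solution_exists:
  assumes G: "simple_graph V E" and q: "q = 2 \<or> q = 3"
  shows "\<exists>Xs. solves (Suc q) V E T Xs \<and> 2 * q * length Xs \<le> 2 * card E + (q - 1) * card V"
  using G
proof (induction "card V" arbitrary: V E T rule: less_induct)
  case less
  note G = less.prems
  have fin: "finite V" using G by (simp add: simple_graph_def)
  show ?case
  proof (cases "V = {}")
    case True
    then have "E = {}" using G by (auto simp: simple_graph_def)
    then show ?thesis using True by (intro exI[of _ "[]"]) (auto simp: solves_def)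
  next
    case False
    then obtain v where v: "v \<in> V" by blast
    define N where "N = nbrs E v"
    define S where "S = {u \<in> N. {v, u} \<in> T}"
    define E1 where "E1 = {e \<in> E. v \<notin> e}"
    have G1: "simple_graph (V - {v}) E1" using simple_graph_delete[OF G] by (simp add: E1_def)
    have NV: "N \<subseteq> V - {v}" using nbrs_subset[OF G] by (simp add: N_def)
    have finN: "finite N" using NV fin finite_subset by blast
    have SN: "S \<subseteq> N" by (auto simp: S_def)
    have finS: "finite S" using SN finN finite_subset by blast
    have cS: "card S \<le> card N" using SN finN by (simp add: card_mono)
    have cE: "card E = card E1 + card N" using card_edges_delete[OF G] by (simp add: E1_def N_def)
    have cV: "card V = Suc (card (V - {v}))" using card_Suc_Diff1[OF fin v] by simp
    show ?thesis
    proof (cases "card S = card N \<and> card N mod q = 1")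
      case False
      from block_count_exists[OF q cS False] obtain k where
        k: "card S \<le> k * q" "2 * q * k \<le> 2 * card N + (q - 1)" by blast
      have "v \<notin> S" using SN NV by auto
      from star_blocks[OF finS k(1) this] obtain Ys where Ys: "length Ys = k"
        "\<forall>X\<in>set Ys. X \<subseteq> insert v S \<and> finite X \<and> card X \<le> Suc q"
        "\<forall>u. u \<noteq> v \<longrightarrow> hits Ys {v, u} = (if u \<in> S then 1 else 0)" by blast
      obtain Xs where Xs: "solves (Suc q) (V - {v}) E1 {e. e \<in> T \<longleftrightarrow> even (hits Ys e)} Xs"
        "2 * q * length Xs \<le> 2 * card E1 + (q - 1) * card (V - {v})"
        using less.hyps[of "V - {v}" E1, OF _ G1] cV by auto
      have "solves (Suc q) V E T (Ys @ Xs)"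
      proof (rule solves_delete[OF G, where v = v])
        show "\<forall>X\<in>set Ys. X \<subseteq> V \<and> finite X \<and> card X \<le> Suc q"
          using Ys(2) SN NV v by blast
        show "odd (hits Ys {v, u}) \<longleftrightarrow> {v, u} \<in> T" if "u \<in> nbrs E v" for u
        proof -
          have "u \<noteq> v" "u \<in> N" using that NV by (auto simp: N_def)
          then show ?thesis using Ys(3) by (simp add: S_def)
        qed
      qed (use Xs(1) in \<open>unfold E1_def\<close>)
      moreover have "2 * q * length (Ys @ Xs) \<le> 2 * card E + (q - 1) * card V"
        using k(2) Xs(2) Ys(1) cE cV by (simp add: algebra_simps)
      ultimately show ?thesis by blast
    next
      case True
      then have "S = N" using SN finN by (simp add: card_subset_eq)
      then have lab: "{v, u} \<in> T" if "u \<in> N" for u using that by (auto simp: S_def)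
      have "N \<noteq> {}" using True q by auto
      then obtain w where w: "w \<in> N" by blast
      have wv: "w \<in> V" "w \<noteq> v" using w NV by auto
      define j where "j = card N div q"
      have dN: "card N = q * j + 1" using True by (metis j_def mult_div_mod_eq)
      define N1 where "N1 = nbrs E1 w"
      define S1 where "S1 = {u \<in> N1. {w, u} \<in> T}"
      define E2 where "E2 = {e \<in> E1. w \<notin> e}"
      define r where "r = card N1 mod q"
      define k where "k = card N1 div q"
      have N1V: "N1 \<subseteq> V - {v} - {w}" using nbrs_subset[OF G1] by (simp add: N1_def)
      have finN1: "finite N1" using N1V fin finite_subset by blast
      have S1N: "S1 \<subseteq> N1" by (auto simp: S1_def)
      have finS1: "finite S1" using S1N finN1 finite_subset by blast
      have rq: "r < q" using q by (auto simp: r_def)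
      have dN1: "card N1 = q * k + r" by (simp add: k_def r_def)
      \<comment> \<open>Up to \<open>r\<close> of the edges at \<open>w\<close> that need reversal
        are handled together with the edge from \<open>v\<close> to \<open>w\<close>. As r < q, the
        set formed by \<open>v\<close>, \<open>w\<close> and \<open>U\<close> has at most q+1
        elements.\<close>
      obtain U where U: "U \<subseteq> S1" "card U = min r (card S1)"
        by (meson min.cobounded2 obtain_subset_with_card_n)
      have finU: "finite U" using U finS1 finite_subset by blast
      have "card (S1 - U) = card S1 - card U" using U finU by (simp add: card_Diff_subset)
      moreover have "card S1 \<le> card N1" using S1N finN1 by (simp add: card_mono)
      ultimately have cS1: "card (S1 - U) \<le> k * q" using U(2) dN1 by (auto simp: min_def mult.commute)
      have UV: "U \<subseteq> V - {v} - {w}" using U(1) S1N N1V by blast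
      \<comment> \<open>The set containing \<open>v\<close>, \<open>w\<close> and \<open>U\<close>
        already repairs the edges from \<open>v\<close> to \<open>w\<close> and to neighbours in
        \<open>U\<close>, so these are left out here. Dropping \<open>w\<close> alone brings the
        degree \<open>q * j + 1\<close> down to a multiple of \<open>q\<close>.\<close>
      have "card (N - insert w U) \<le> card (N - {w})" using finN by (intro card_mono) auto
      also have "\<dots> = j * q" using w finN dN by (simp add: mult.commute)
      finally have cNU: "card (N - insert w U) \<le> j * q" .
      have "v \<notin> N - insert w U" using NV by auto
      from star_blocks[OF _ cNU this] finN obtain Zs where Zs: "length Zs = j"
        "\<forall>X\<in>set Zs. X \<subseteq> insert v (N - insert w U) \<and> finite X \<and> card X \<le> Suc q"
        "\<forall>u. u \<noteq> v \<longrightarrow> hits Zs {v, u} = (if u \<in> N - insert w U then 1 else 0)" by blast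
      \<comment> \<open>Putting \<open>U\<close> into the set of \<open>w\<close> reverses exactly the edges from \<open>w\<close> to \<open>U\<close>, leaving at most
        \<open>k * q\<close> edges to be reversed at \<open>w\<close>.\<close>
      define Ys where "Ys = insert v (insert w U) # Zs"
      have hw: "hits Zs {w, u} = 0" for u using Zs(2) wv by (intro hits_eq_0) blast
      have hYw: "hits Ys {w, u} = (if u \<in> U then 1 else 0)" if "u \<noteq> w" "u \<noteq> v" for u
        using that hw[of u] wv by (auto simp: Ys_def)
      have hYv: "hits Ys {v, u} = 1" if "u \<in> N" for u
        using that Zs(3) NV by (auto simp: Ys_def)
      have cB: "card (insert v (insert w U)) \<le> Suc q"
        using finU U(2) rq by (auto simp: card_insert_if)
      have YsV: "\<forall>X\<in>set Ys. X \<subseteq> V \<and> finite X \<and> card X \<le> Suc q"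
        using Zs(2) cB finU UV wv v NV unfolding Ys_def by (simp; blast)
      define T1 where "T1 = {e. e \<in> T \<longleftrightarrow> even (hits Ys e)}"
      have S1': "u \<in> S1 - U \<longleftrightarrow> {w, u} \<in> T1" if "u \<in> N1" for u
      proof -
        have "u \<noteq> w" "u \<noteq> v" using that N1V by auto
        then show ?thesis using that hYw[of u] U(1) by (auto simp: T1_def S1_def)
      qed
      have "w \<notin> S1 - U" using S1N N1V by auto
      from star_blocks[OF _ cS1 this] finS1 obtain Ws where Ws: "length Ws = k"
        "\<forall>X\<in>set Ws. X \<subseteq> insert w (S1 - U) \<and> finite X \<and> card X \<le> Suc q"
        "\<forall>u. u \<noteq> w \<longrightarrow> hits Ws {w, u} = (if u \<in> S1 - U then 1 else 0)" by blast
      have G2: "simple_graph (V - {v} - {w}) E2" using simple_graph_delete[OF G1] by (simp add: E2_def)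
      have cV2: "card V = Suc (Suc (card (V - {v} - {w})))"
        using cV card_Suc_Diff1[of "V - {v}" w] wv fin by simp
      have cE1: "card E1 = card E2 + card N1"
        using card_edges_delete[OF G1] by (simp add: E2_def N1_def)
      obtain Xs where Xs: "solves (Suc q) (V - {v} - {w}) E2 {e. e \<in> T1 \<longleftrightarrow> even (hits Ws e)} Xs"
        "2 * q * length Xs \<le> 2 * card E2 + (q - 1) * card (V - {v} - {w})"
        using less.hyps[of "V - {v} - {w}" E2, OF _ G2] cV2 by auto
      have "solves (Suc q) (V - {v}) E1 T1 (Ws @ Xs)"
      proof (rule solves_delete[OF G1, where v = w])
        show "\<forall>X\<in>set Ws. X \<subseteq> V - {v} \<and> finite X \<and> card X \<le> Suc q"
          using Ws(2) S1N N1V wv by blast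
        show "odd (hits Ws {w, u}) \<longleftrightarrow> {w, u} \<in> T1" if "u \<in> nbrs E1 w" for u
        proof -
          have "u \<noteq> w" "u \<in> N1" using that N1V by (auto simp: N1_def)
          then show ?thesis using Ws(3) S1' by simp
        qed
      qed (use Xs(1) in \<open>unfold E2_def\<close>)
      then have sol: "solves (Suc q) (V - {v}) {e \<in> E. v \<notin> e} {e. e \<in> T \<longleftrightarrow> even (hits Ys e)} (Ws @ Xs)"
        unfolding E1_def T1_def .
      have "solves (Suc q) V E T (Ys @ Ws @ Xs)"
      proof (rule solves_delete[OF G YsV _ sol])
        show "odd (hits Ys {v, u}) \<longleftrightarrow> {v, u} \<in> T" if "u \<in> nbrs E v" for u
          using that hYv lab by (simp add: N_def)
      qed
      \<comment> \<open>The two deletions use \<open>1 + j + k\<close> sets. Multiplied by 2q this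
        is 2q + 2(\<open>card N\<close> - 1) + 2(\<open>card N1\<close> - r), which stays within the
        joint budget 2(\<open>card N\<close> + \<open>card N1\<close>) + 2(q-1).\<close>
      moreover have "2 * q * length (Ys @ Ws @ Xs) \<le> 2 * card E + (q - 1) * card V"
        using q
      proof
        assume "q = 2"
        then show ?thesis
          using Xs(2) Ws(1) Zs(1) cE cV2 cE1 dN dN1 by (simp add: Ys_def)
      next
        assume "q = 3"
        then show ?thesis
          using Xs(2) Ws(1) Zs(1) cE cV2 cE1 dN dN1 by (simp add: Ys_def)
      qed
      ultimately show ?thesis by blast
    qed
  qed
qed

section \<open>From solutions to the inversion diameter\<close>

lemma inv_dist_le:
  assumes "simple_graph V E" "is_orientation V E A" "is_orientation V E B" "q = 2 \<or> q = 3"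
  shows "2 * q * inv_dist (Suc q) V A B \<le> 2 * card E + (q - 1) * card V"
    and "\<exists>Xs. (\<forall>X\<in>set Xs. X \<subseteq> V \<and> finite X \<and> card X \<le> Suc q) \<and> fold invert Xs A = B"
proof -
  obtain Xs where Xs: "solves (Suc q) V E {{u, v} | u v. (u, v) \<in> A - B} Xs"
    "2 * q * length Xs \<le> 2 * card E + (q - 1) * card V"
    using solution_exists[OF assms(1,4)] by blast
  have *: "(\<forall>X\<in>set Xs. X \<subseteq> V \<and> finite X \<and> card X \<le> Suc q) \<and> fold invert Xs A = B"
    using Xs(1) fold_invert_solves[OF assms(2,3) Xs(1)] by (simp add: solves_def)
  \<comment> \<open>Kept as a separate fact: the \<open>LEAST\<close> in \<open>inv_dist\<close> is
    known to be attained only once some list of inversions exists.\<close>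
  then show "\<exists>Xs. (\<forall>X\<in>set Xs. X \<subseteq> V \<and> finite X \<and> card X \<le> Suc q) \<and> fold invert Xs A = B"
    by blast
  have "inv_dist (Suc q) V A B \<le> length Xs"
    unfolding inv_dist_def using * by (intro Least_le) blast
  then show "2 * q * inv_dist (Suc q) V A B \<le> 2 * card E + (q - 1) * card V"
    using Xs(2) by (meson le_trans mult_le_mono2)
qed

text \<open>A shortest list for \<open>p\<close> exists by the second hypothesis, and it is
  admissible for \<open>p'\<close> too.\<close>

lemma inv_dist_antimono:
  assumes "p \<le> p'"
    and "\<exists>Xs. (\<forall>X\<in>set Xs. X \<subseteq> V \<and> finite X \<and> card X \<le> p) \<and> fold invert Xs A = B"
  shows "inv_dist p' V A B \<le> inv_dist p V A B"
proof -
  let ?P = "\<lambda>k. \<exists>Xs. length Xs = k \<and> (\<forall>X\<in>set Xs. X \<subseteq> V \<and> finite X \<and> card X \<le> p) \<and> fold invert Xs A = B"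
  have "?P (inv_dist p V A B)"
    unfolding inv_dist_def using assms(2) by (intro LeastI_ex[of ?P]) blast
  then obtain Xs where Xs: "length Xs = inv_dist p V A B"
    "\<forall>X\<in>set Xs. X \<subseteq> V \<and> finite X \<and> card X \<le> p" "fold invert Xs A = B" by blast
  have "\<forall>X\<in>set Xs. X \<subseteq> V \<and> finite X \<and> card X \<le> p'" using Xs(2) assms(1) by fastforce
  then show ?thesis
    unfolding inv_dist_def[of p'] using Xs(1,3) by (intro Least_le) blast
qed

lemma finite_inv_dists:
  assumes "finite V"
  shows "finite {inv_dist p V A B | A B. is_orientation V E A \<and> is_orientation V E B}"
proof (rule finite_subset)
  show "{inv_dist p V A B | A B. is_orientation V E A \<and> is_orientation V E B}
    \<subseteq> (\<lambda>(A, B). inv_dist p V A B) ` (Pow (V \<times> V) \<times> Pow (V \<times> V))"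
    by (auto simp: is_orientation_def image_iff)
qed (use assms in simp)

text \<open>Direct every edge upwards along an injection into the naturals. This makes the set of
  distances nonempty, so that its \<open>Max\<close> is one of its members.\<close>

lemma orientation_exists:
  assumes "simple_graph V E"
  shows "\<exists>A. is_orientation V E A"
proof -
  obtain g :: "'a \<Rightarrow> nat" where g: "inj_on g V"
    using assms finite_imp_inj_to_nat_seg by (metis simple_graph_def)
  let ?A = "{(u, v). {u, v} \<in> E \<and> g u < g v}"
  have "u \<in> V \<and> v \<in> V \<and> u \<noteq> v" if "{u, v} \<in> E" for u v
    using nbrs_subset[OF assms, of u] nbrs_subset[OF assms, of v] that
    by (auto simp: nbrs_def insert_commute)
  then have "is_orientation V E ?A"
    unfolding is_orientation_def using g
    by (auto simp: insert_commute inj_on_def) (metis linorder_neqE_nat)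
  then show ?thesis by blast
qed

lemma inv_diam_le:
  assumes "simple_graph V E" "q = 2 \<or> q = 3"
  shows "2 * q * inv_diam (Suc q) V E \<le> 2 * card E + (q - 1) * card V"
proof -
  let ?D = "{inv_dist (Suc q) V A B | A B. is_orientation V E A \<and> is_orientation V E B}"
  have "Max ?D \<in> ?D"
    using finite_inv_dists orientation_exists[OF assms(1)] assms(1)
    by (intro Max_in) (auto simp: simple_graph_def)
  then show ?thesis using inv_dist_le(1)[OF assms(1) _ _ assms(2)] by (auto simp: inv_diam_def)
qed

lemma inv_diam_antimono:
  assumes "simple_graph V E" "q = 2 \<or> q = 3" "Suc q \<le> p"
  shows "inv_diam p V E \<le> inv_diam (Suc q) V E"
proof -
  let ?D = "\<lambda>p. {inv_dist p V A B | A B. is_orientation V E A \<and> is_orientation V E B}"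
  have fin: "finite (?D p)" for p using finite_inv_dists assms(1) by (auto simp: simple_graph_def)
  have ne: "?D p \<noteq> {}" using orientation_exists[OF assms(1)] by blast
  show ?thesis unfolding inv_diam_def
  proof (rule Max.boundedI[OF fin ne])
    fix x assume "x \<in> ?D p"
    then obtain A B where AB: "x = inv_dist p V A B" "is_orientation V E A" "is_orientation V E B" by blast
    have "x \<le> inv_dist (Suc q) V A B"
      using inv_dist_antimono[OF assms(3) inv_dist_le(2)[OF assms(1) AB(2,3) assms(2)]] AB(1) by simp
    also have "\<dots> \<le> Max (?D (Suc q))" using fin AB by (intro Max_ge) auto
    finally show "x \<le> Max (?D (Suc q))" .
  qed
qed

section \<open>Paths and cycles\<close>

fun path_edges :: "'a list \<Rightarrow> 'a set set" where
  "path_edges (x # y # zs) = insert {x, y} (path_edges (y # zs))"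
| "path_edges _ = {}"

lemma path_edges_append:
  "path_edges (xs @ x # ys) = path_edges (xs @ [x]) \<union> path_edges (x # ys)"
proof (induction xs)
  case (Cons z zs)
  then show ?case by (cases zs) auto
qed simp

lemma path_edges_snoc:
  "xs \<noteq> [] \<Longrightarrow> path_edges (xs @ [y]) = insert {last xs, y} (path_edges xs)"
proof (induction xs)
  case (Cons z zs)
  then show ?case by (cases zs) auto
qed simp

lemma path_edges_Cons:
  "xs \<noteq> [] \<Longrightarrow> path_edges (x # xs) = insert {x, hd xs} (path_edges xs)"
  by (cases xs) auto

lemma path_edges_rev [simp]: "path_edges (rev xs) = path_edges xs"
proof (induction xs)
  case (Cons z zs)
  then show ?case
    by (cases "zs = []") (auto simp: path_edges_snoc path_edges_Cons last_rev)
qed simp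

lemma path_edges_subset: "e \<in> path_edges xs \<Longrightarrow> e \<subseteq> set xs"
  by (induction xs rule: path_edges.induct) auto

lemma Union_path_edges: "length xs \<ge> 2 \<Longrightarrow> \<Union>(path_edges xs) = set xs"
proof (induction xs rule: path_edges.induct)
  case (1 x y zs)
  then show ?case by (cases zs) auto
qed auto

lemma finite_path_edges [simp]: "finite (path_edges xs)"
  by (induction xs rule: path_edges.induct) auto

lemma card_path_edges_le: "card (path_edges xs) \<le> length xs - 1"
proof (induction xs rule: path_edges.induct)
  case (1 x y zs)
  have "card (insert {x, y} (path_edges (y # zs))) \<le> Suc (card (path_edges (y # zs)))"
    by (rule card_insert_le_m1) auto
  then show ?case using 1 by simp
qed auto

lemma path_edges_doubleton:
  "distinct xs \<Longrightarrow> e \<in> path_edges xs \<Longrightarrow> \<exists>x y. x \<noteq> y \<and> e = {x, y}"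
proof (induction xs rule: path_edges.induct)
  case (1 x y zs)
  then show ?case by auto
qed auto

lemma path_edges_ends:
  assumes "distinct (a # ys @ [b])" "{a, b} \<in> path_edges (a # ys @ [b])"
  shows "ys = []"
proof (cases ys)
  case (Cons y ys')
  have "{a, b} \<noteq> {a, y}" using assms(1) Cons by (auto simp: doubleton_eq_iff)
  then have "{a, b} \<in> path_edges (y # ys' @ [b])" using assms(2) Cons by auto
  then have "a \<in> set (y # ys' @ [b])" using path_edges_subset by blast
  then show ?thesis using assms(1) Cons by auto
qed

text \<open>A common edge can only join the common vertices \<open>a\<close> and \<open>b\<close>; a
  path containing that edge consists of nothing else, but one of the two is longer.\<close>

lemma path_edges_disjoint:
  assumes "distinct (a # b # ys @ zs)" "ys \<noteq> [] \<or> zs \<noteq> []"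
  shows "path_edges (a # ys @ [b]) \<inter> path_edges (a # zs @ [b]) = {}"
proof (rule ccontr)
  assume "\<not> ?thesis"
  then obtain e where e: "e \<in> path_edges (a # ys @ [b])" "e \<in> path_edges (a # zs @ [b])" by blast
  have d: "distinct (a # ys @ [b])" "distinct (a # zs @ [b])" using assms(1) by auto
  have "e \<subseteq> {a, b}"
    using path_edges_subset[OF e(1)] path_edges_subset[OF e(2)] assms(1) by auto
  moreover obtain x y where "x \<noteq> y" "e = {x, y}" using path_edges_doubleton[OF d(1) e(1)] by blast
  ultimately have "e = {a, b}" by auto
  then show False using path_edges_ends d e assms(2) by metis
qed

text \<open>Extend the path along each step of the closure; when the new vertex already lies on the
  path, cut the path off there.\<close>

lemma rtrancl_path:
  assumes "(x, y) \<in> R\<^sup>*" "x \<in> I" and R: "\<And>a b. (a, b) \<in> R \<Longrightarrow> b \<in> I \<and> {a, b} \<in> D"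
  shows "\<exists>ws. ws \<noteq> [] \<and> hd ws = x \<and> last ws = y \<and> distinct ws \<and> set ws \<subseteq> I \<and> path_edges ws \<subseteq> D"
  using assms(1)
proof (induction rule: rtrancl_induct)
  case base
  then show ?case using assms(2) by (intro exI[of _ "[x]"]) auto
next
  case (step y z)
  then obtain ws where ws: "ws \<noteq> []" "hd ws = x" "last ws = y" "distinct ws" "set ws \<subseteq> I"
    "path_edges ws \<subseteq> D" by blast
  show ?case
  proof (cases "z \<in> set ws")
    case True
    then obtain us vs where "ws = us @ z # vs" by (meson split_list)
    then show ?thesis
      using ws path_edges_append[of us z vs] by (intro exI[of _ "us @ [z]"]) (cases us; auto)
  next
    case False
    then show ?thesis
      using ws R[OF step.hyps(2)] by (intro exI[of _ "ws @ [z]"]) (auto simp: path_edges_snoc)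
  qed
qed

section \<open>Cycles as pairs of paths\<close>

definition cycle_edges :: "'a list \<Rightarrow> 'a set set" where
  "cycle_edges cs = path_edges (cs @ [hd cs])"

definition is_cycle :: "'a set set \<Rightarrow> 'a list \<Rightarrow> bool" where
  "is_cycle E cs \<longleftrightarrow> distinct cs \<and> 3 \<le> length cs \<and> cycle_edges cs \<subseteq> E"

lemma card_cycle_edges_le: "card (cycle_edges cs) \<le> length cs"
  using card_path_edges_le[of "cs @ [hd cs]"] by (simp add: cycle_edges_def)

lemma finite_cycle_edges [simp]: "finite (cycle_edges cs)"
  by (simp add: cycle_edges_def)

lemma Union_cycle_edges: "cs \<noteq> [] \<Longrightarrow> \<Union>(cycle_edges cs) = set cs"
  unfolding cycle_edges_def by (subst Union_path_edges) (cases cs; auto)+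

lemma cycle_edges_rotate: "cycle_edges (us @ vs) = cycle_edges (vs @ us)"
proof (cases "us = [] \<or> vs = []")
  case False
  then obtain u us' v vs' where "us = u # us'" "vs = v # vs'" by (metis neq_Nil_conv)
  then show ?thesis
    using path_edges_append[of "u # us'" v "vs' @ [u]"] path_edges_append[of "v # vs'" u "us' @ [v]"]
    by (auto simp: cycle_edges_def)
qed auto

lemma cycle_edges_two_paths:
  "cycle_edges (a # ys @ b # rev zs) = path_edges (a # ys @ [b]) \<union> path_edges (a # zs @ [b])"
proof -
  have "path_edges (b # rev zs @ [a]) = path_edges (rev (a # zs @ [b]))" by simp
  then have "path_edges (b # rev zs @ [a]) = path_edges (a # zs @ [b])"
    using path_edges_rev by metis
  then show ?thesis
    using path_edges_append[of "a # ys" b "rev zs @ [a]"] by (simp add: cycle_edges_def)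
qed

text \<open>Rotate the cycle until it starts at \<open>a\<close> and cut it at \<open>b\<close>. The
  second part is reversed so that both paths lead from \<open>a\<close> to \<open>b\<close>, as the
  theta curve argument requires.\<close>

lemma cycle_split:
  assumes "distinct cs" "3 \<le> length cs" "a \<in> set cs" "b \<in> set cs" "a \<noteq> b"
  obtains ys zs where "distinct (a # b # ys @ zs)" "set cs = insert a (insert b (set ys \<union> set zs))"
    "length cs = length ys + length zs + 2"
    "cycle_edges cs = path_edges (a # ys @ [b]) \<union> path_edges (a # zs @ [b])"
proof -
  obtain us vs where cs: "cs = us @ a # vs" using assms(3) by (meson split_list)
  have "b \<in> set (vs @ us)" using assms(4,5) cs by auto
  then obtain ys zs where yz: "vs @ us = ys @ b # zs" by (meson split_list)
  have "cycle_edges cs = cycle_edges (a # vs @ us)" using cycle_edges_rotate[of us "a # vs"] cs by simp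
  also have "\<dots> = cycle_edges (a # ys @ b # rev (rev zs))" using yz by simp
  also have "\<dots> = path_edges (a # ys @ [b]) \<union> path_edges (a # rev zs @ [b])"
    by (rule cycle_edges_two_paths)
  finally have 1: "cycle_edges cs = path_edges (a # ys @ [b]) \<union> path_edges (a # rev zs @ [b])" .
  have "distinct (a # vs @ us)" using assms(1) cs by auto
  then have 2: "distinct (a # b # ys @ rev zs)" unfolding yz by auto
  have "set cs = insert a (set (vs @ us))" using cs by auto
  then have 3: "set cs = insert a (insert b (set ys \<union> set (rev zs)))" unfolding yz by auto
  have "length cs = Suc (length (vs @ us))" using cs by simp
  then have 4: "length cs = length ys + length (rev zs) + 2" unfolding yz by simp
  show ?thesis by (rule that[OF 2 3 4 1])
qed

lemma is_cycle_two_paths: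
  assumes "distinct (a # b # ys @ zs)" "ys \<noteq> [] \<or> zs \<noteq> []"
    "path_edges (a # ys @ [b]) \<subseteq> E" "path_edges (a # zs @ [b]) \<subseteq> E"
  shows "is_cycle E (a # ys @ b # rev zs)"
  unfolding is_cycle_def cycle_edges_two_paths using assms by (cases ys; cases zs) auto

text \<open>All neighbours of the first vertex \<open>x\<close> of a longest path lie on that path.
  One of them differs from the successor of \<open>x\<close>, and its edge to \<open>x\<close>
  closes a cycle.\<close>

lemma min_degree_cycle:
  assumes G: "simple_graph V E" and "V \<noteq> {}" and deg: "\<And>v. v \<in> V \<Longrightarrow> 2 \<le> card (nbrs E v)"
  shows "\<exists>cs. is_cycle E cs"
proof -
  let ?P = "\<lambda>xs. distinct xs \<and> xs \<noteq> [] \<and> set xs \<subseteq> V \<and> path_edges xs \<subseteq> E"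
  have fin: "finite V" using G by (simp add: simple_graph_def)
  obtain v where "v \<in> V" using assms(2) by blast
  then have "?P [v]" by simp
  moreover have "\<forall>xs. ?P xs \<longrightarrow> length xs < Suc (card V)"
  proof (intro allI impI)
    fix xs assume "?P xs"
    then have "length xs = card (set xs)" "card (set xs) \<le> card V"
      using fin distinct_card[of xs] card_mono[of V "set xs"] by auto
    then show "length xs < Suc (card V)" by simp
  qed
  ultimately obtain xs where xs: "?P xs" and max: "\<And>ys. ?P ys \<Longrightarrow> length ys \<le> length xs"
    using ex_has_greatest_nat[of ?P "[v]" length "Suc (card V)"] by blast
  then obtain x zs where x: "xs = x # zs" by (cases xs) auto
  have sub: "nbrs E x \<subseteq> set zs"
  proof
    fix y assume y: "y \<in> nbrs E x"
    then have yV: "y \<in> V" "y \<noteq> x" using nbrs_subset[OF G] by auto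
    have e: "{y, x} \<in> E" using y by (simp add: nbrs_def insert_commute)
    show "y \<in> set zs"
    proof (rule ccontr)
      assume "y \<notin> set zs"
      then have "?P (y # xs)" using xs x yV e by simp
      from max[OF this] show False by simp
    qed
  qed
  have d: "2 \<le> card (nbrs E x)" using deg xs x by auto
  obtain z zs' where z: "zs = z # zs'" using d sub by (cases zs) auto
  have "\<not> nbrs E x \<subseteq> {z}" using d card_mono[of "{z}" "nbrs E x"] by auto
  then obtain y where y: "y \<in> nbrs E x" "y \<noteq> z" by blast
  then have "y \<in> set zs'" using sub z by auto
  then obtain us vs where us: "zs' = us @ y # vs" by (meson split_list)
  have e: "{y, x} \<in> E" using y by (simp add: nbrs_def insert_commute)
  have xs_eq: "xs = (x # z # us) @ y # vs" using x z us by simp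
  have "path_edges ((x # z # us) @ [y]) \<subseteq> E"
    using xs unfolding xs_eq path_edges_append[of "x # z # us" y vs] by blast
  then have "cycle_edges (x # z # us @ [y]) \<subseteq> E"
    using e path_edges_snoc[of "x # z # us @ [y]" x] by (simp add: cycle_edges_def)
  moreover have "distinct (x # z # us @ [y])" using xs unfolding xs_eq by auto
  ultimately have "is_cycle E (x # z # us @ [y])" unfolding is_cycle_def by simp
  then show ?thesis by blast
qed

section \<open>Plane graphs\<close>

definition curves :: "('a set \<Rightarrow> real \<Rightarrow> complex) \<Rightarrow> 'a set set \<Rightarrow> complex set" where
  "curves \<gamma> F = (\<Union>e\<in>F. path_image (\<gamma> e))"

lemma curves_simps [simp]:
  "curves \<gamma> {} = {}" "curves \<gamma> (insert e F) = path_image (\<gamma> e) \<union> curves \<gamma> F"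
  "curves \<gamma> (F \<union> F') = curves \<gamma> F \<union> curves \<gamma> F'"
  by (auto simp: curves_def)

text \<open>The graph together with one fixed drawing, so that restricting the graph or transforming
  the drawing yields further instances.\<close>

locale plane_graph =
  fixes V :: "'a set" and E :: "'a set set" and f :: "'a \<Rightarrow> complex" and \<gamma> :: "'a set \<Rightarrow> real \<Rightarrow> complex"
  assumes G: "simple_graph V E"
    and inj: "inj_on f V"
    and arcs: "\<And>e. e \<in> E \<Longrightarrow> arc (\<gamma> e)"
    and ends: "\<And>e. e \<in> E \<Longrightarrow> {pathstart (\<gamma> e), pathfinish (\<gamma> e)} = f ` e"
    and avoid: "\<And>e v. e \<in> E \<Longrightarrow> v \<in> V \<Longrightarrow> f v \<in> path_image (\<gamma> e) \<Longrightarrow> v \<in> e"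
    and cross: "\<And>e e'. e \<in> E \<Longrightarrow> e' \<in> E \<Longrightarrow> e \<noteq> e' \<Longrightarrow>
                  path_image (\<gamma> e) \<inter> path_image (\<gamma> e') \<subseteq> f ` (e \<inter> e')"

lemma planar_imp_plane_graph:
  assumes "simple_graph V E" "planar V E"
  shows "\<exists>f \<gamma>. plane_graph V E f \<gamma>"
  using assms(2) unfolding planar_def
proof (elim exE conjE)
  fix f :: "'a \<Rightarrow> complex" and \<gamma>
  assume *: "inj_on f V"
    "\<forall>e\<in>E. arc (\<gamma> e) \<and> {pathstart (\<gamma> e), pathfinish (\<gamma> e)} = f ` e"
    "\<forall>e\<in>E. \<forall>v\<in>V. f v \<in> path_image (\<gamma> e) \<longrightarrow> v \<in> e"
    "\<forall>e\<in>E. \<forall>e'\<in>E. e \<noteq> e' \<longrightarrow> path_image (\<gamma> e) \<inter> path_image (\<gamma> e') \<subseteq> f ` (e \<inter> e')"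
  have "plane_graph V E f \<gamma>" by unfold_locales (use assms(1) * in simp_all)
  then show ?thesis by blast
qed

lemma plane_graph_subgraph:
  assumes "plane_graph V E f \<gamma>" "V' \<subseteq> V" "E' \<subseteq> E" "\<And>e. e \<in> E' \<Longrightarrow> e \<subseteq> V'"
  shows "plane_graph V' E' f \<gamma>"
proof -
  interpret plane_graph V E f \<gamma> by fact
  have "simple_graph V' E'"
    unfolding simple_graph_def
  proof (intro conjI ballI)
    show "finite V'" using G assms(2) finite_subset by (auto simp: simple_graph_def)
    fix e assume e: "e \<in> E'"
    then obtain u v where "u \<noteq> v" "e = {u, v}" using G assms(3) unfolding simple_graph_def by (meson subsetD)
    then show "\<exists>u v. u \<noteq> v \<and> u \<in> V' \<and> v \<in> V' \<and> e = {u, v}" using assms(4)[OF e] by blast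
  qed
  moreover have "inj_on f V'" using inj assms(2) inj_on_subset by blast
  ultimately show ?thesis
    using arcs ends avoid cross subsetD[OF assms(2)] subsetD[OF assms(3)] by unfold_locales simp_all
qed

context plane_graph
begin

lemma finite_V: "finite V" using G by (simp add: simple_graph_def)

lemma finite_E: "finite E" using G by (rule simple_graph_finite_edges)

lemma edge_subset: "e \<in> E \<Longrightarrow> e \<subseteq> V"
  using G by (auto simp: simple_graph_def)

lemma ends_on_curve: "e \<in> E \<Longrightarrow> f ` e \<subseteq> path_image (\<gamma> e)"
  using ends[of e] by (metis insert_subset empty_subsetI pathfinish_in_path_image pathstart_in_path_image)

text \<open>A drawing prescribes the ends of a curve only as a set; if they come in the wrong order,
  the curve is reversed.\<close>

lemma edge_arc:
  assumes "{x, y} \<in> E"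
  obtains g where "arc g" "pathstart g = f x" "pathfinish g = f y" "path_image g = path_image (\<gamma> {x, y})"
proof -
  have "{pathstart (\<gamma> {x, y}), pathfinish (\<gamma> {x, y})} = {f x, f y}" using ends[OF assms] by simp
  then consider "pathstart (\<gamma> {x, y}) = f x" "pathfinish (\<gamma> {x, y}) = f y"
    | "pathstart (\<gamma> {x, y}) = f y" "pathfinish (\<gamma> {x, y}) = f x"
    by (metis doubleton_eq_iff)
  then show ?thesis
  proof cases
    case 1
    then show ?thesis using arcs[OF assms] that by blast
  next
    case 2
    then show ?thesis using arcs[OF assms] by (intro that[of "reversepath (\<gamma> {x, y})"]) (auto simp: arc_reversepath)
  qed
qed

lemma curves_Int_subset:
  assumes "F \<subseteq> E" "F' \<subseteq> E" "F \<inter> F' = {}"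
  shows "curves \<gamma> F \<inter> curves \<gamma> F' \<subseteq> f ` (\<Union>F \<inter> \<Union>F')"
proof
  fix z assume "z \<in> curves \<gamma> F \<inter> curves \<gamma> F'"
  then obtain e e' where e: "e \<in> F" "e' \<in> F'" "z \<in> path_image (\<gamma> e) \<inter> path_image (\<gamma> e')"
    by (auto simp: curves_def)
  then have "z \<in> f ` (e \<inter> e')" using cross[of e e'] assms by blast
  then show "z \<in> f ` (\<Union>F \<inter> \<Union>F')" using e by blast
qed

lemma ends_on_curves: "F \<subseteq> E \<Longrightarrow> f ` \<Union>F \<subseteq> curves \<gamma> F"
  using ends_on_curve by (fastforce simp: curves_def)

lemma vertex_on_curves: "F \<subseteq> E \<Longrightarrow> v \<in> V \<Longrightarrow> f v \<in> curves \<gamma> F \<longleftrightarrow> v \<in> \<Union>F"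
  using avoid ends_on_curves[of F] by (fastforce simp: curves_def)

text \<open>Join the curves one at a time. The first vertex does not occur later, so the first curve
  meets the remaining arc only in their common end.\<close>

lemma path_arc:
  assumes "distinct xs" "2 \<le> length xs" "path_edges xs \<subseteq> E"
  shows "\<exists>g. arc g \<and> pathstart g = f (hd xs) \<and> pathfinish g = f (last xs) \<and>
           path_image g = curves \<gamma> (path_edges xs)"
  using assms
proof (induction xs rule: path_edges.induct)
  case (1 x y zs)
  have xy: "{x, y} \<in> E" using "1.prems" by simp
  from edge_arc[OF this] obtain g where g: "arc g" "pathstart g = f x" "pathfinish g = f y"
    "path_image g = path_image (\<gamma> {x, y})" by blast
  show ?case
  proof (cases zs)
    case Nil
    then show ?thesis using g by auto
  next
    case (Cons z zs')
    then obtain h where h: "arc h" "pathstart h = f y" "pathfinish h = f (last (y # zs))"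
      "path_image h = curves \<gamma> (path_edges (y # zs))" using 1 by auto
    have x: "x \<notin> \<Union>(path_edges (y # zs))" using path_edges_subset "1.prems"(1) by fastforce
    have "path_image g \<inter> path_image h \<subseteq> f ` (\<Union>{{x, y}} \<inter> \<Union>(path_edges (y # zs)))"
    proof -
      have "{{x, y}} \<inter> path_edges (y # zs) = {}" using x by auto
      then show ?thesis
        using curves_Int_subset[of "{{x, y}}" "path_edges (y # zs)"] "1.prems"(3) g(4) h(4) by simp
    qed
    also have "\<dots> \<subseteq> {f y}" using x by auto
    finally have "path_image g \<inter> path_image h \<subseteq> {pathstart h}" using h(2) by simp
    then have "arc (g +++ h)" using g h by (intro arc_join) auto
    then show ?thesis using g h by (intro exI[of _ "g +++ h"]) (auto simp: path_image_join)
  qed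
qed auto

lemma two_paths_Int:
  assumes "distinct (a # b # ys @ zs)" "path_edges (a # ys @ [b]) \<subseteq> E" "path_edges (a # zs @ [b]) \<subseteq> E"
    "path_edges (a # ys @ [b]) \<inter> path_edges (a # zs @ [b]) = {}"
  shows "curves \<gamma> (path_edges (a # ys @ [b])) \<inter> curves \<gamma> (path_edges (a # zs @ [b])) = {f a, f b}"
proof -
  have U: "\<Union>(path_edges (a # us @ [b])) = insert a (insert b (set us))" for us
    by (subst Union_path_edges) auto
  have "insert a (insert b (set ys)) \<inter> insert a (insert b (set zs)) = {a, b}" using assms(1) by auto
  then show ?thesis
    using curves_Int_subset[OF assms(2-4)] ends_on_curves[OF assms(2)] ends_on_curves[OF assms(3)]
    unfolding U by auto
qed

text \<open>The library's theta curve theorem for the arcs of three internally disjoint paths from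
  \<open>a\<close> to \<open>b\<close>; \<open>meets\<close> says that the third one runs through
  the inside of the closed curve formed by the other two.\<close>

lemma theta:
  assumes d: "distinct (a # b # ys @ zs @ ws)"
    and sub: "path_edges (a # ys @ [b]) \<subseteq> E" "path_edges (a # zs @ [b]) \<subseteq> E" "path_edges (a # ws @ [b]) \<subseteq> E"
    and disj: "path_edges (a # ys @ [b]) \<inter> path_edges (a # zs @ [b]) = {}"
      "path_edges (a # ys @ [b]) \<inter> path_edges (a # ws @ [b]) = {}"
      "path_edges (a # zs @ [b]) \<inter> path_edges (a # ws @ [b]) = {}"
    and ab: "f a \<noteq> f b"
    and meets: "curves \<gamma> (path_edges (a # ws @ [b])) \<inter>
      inside (curves \<gamma> (path_edges (a # ys @ [b])) \<union> curves \<gamma> (path_edges (a # zs @ [b]))) \<noteq> {}"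
  shows "inside (curves \<gamma> (path_edges (a # ys @ [b])) \<union> curves \<gamma> (path_edges (a # ws @ [b]))) \<inter>
         inside (curves \<gamma> (path_edges (a # zs @ [b])) \<union> curves \<gamma> (path_edges (a # ws @ [b]))) = {}"
    and "inside (curves \<gamma> (path_edges (a # ys @ [b])) \<union> curves \<gamma> (path_edges (a # ws @ [b]))) \<union>
         inside (curves \<gamma> (path_edges (a # zs @ [b])) \<union> curves \<gamma> (path_edges (a # ws @ [b]))) \<union>
         (curves \<gamma> (path_edges (a # ws @ [b])) - {f a, f b}) =
         inside (curves \<gamma> (path_edges (a # ys @ [b])) \<union> curves \<gamma> (path_edges (a # zs @ [b])))"
proof -
  have arc: "\<exists>g. arc g \<and> pathstart g = f a \<and> pathfinish g = f b \<and> path_image g = curves \<gamma> (path_edges (a # us @ [b]))"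
    if "distinct (a # us @ [b])" "path_edges (a # us @ [b]) \<subseteq> E" for us
    using path_arc[OF that(1) _ that(2)] by simp
  obtain c1 where c1: "arc c1" "pathstart c1 = f a" "pathfinish c1 = f b"
    "path_image c1 = curves \<gamma> (path_edges (a # ys @ [b]))" using arc[OF _ sub(1)] d by auto
  obtain c2 where c2: "arc c2" "pathstart c2 = f a" "pathfinish c2 = f b"
    "path_image c2 = curves \<gamma> (path_edges (a # zs @ [b]))" using arc[OF _ sub(2)] d by auto
  obtain c where c: "arc c" "pathstart c = f a" "pathfinish c = f b"
    "path_image c = curves \<gamma> (path_edges (a # ws @ [b]))" using arc[OF _ sub(3)] d by auto
  have I: "path_image c1 \<inter> path_image c2 = {f a, f b}" "path_image c1 \<inter> path_image c = {f a, f b}"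
    "path_image c2 \<inter> path_image c = {f a, f b}"
    unfolding c1(4) c2(4) c(4)
    by (rule two_paths_Int; use d sub disj in auto)+
  have sp: "simple_path c1" "simple_path c2" "simple_path c"
    using c1 c2 c arc_imp_simple_path by auto
  have m: "path_image c \<inter> inside (path_image c1 \<union> path_image c2) \<noteq> {}"
    unfolding c1(4) c2(4) c(4) by (rule meets)
  show "inside (curves \<gamma> (path_edges (a # ys @ [b])) \<union> curves \<gamma> (path_edges (a # ws @ [b]))) \<inter>
         inside (curves \<gamma> (path_edges (a # zs @ [b])) \<union> curves \<gamma> (path_edges (a # ws @ [b]))) = {}"
    and "inside (curves \<gamma> (path_edges (a # ys @ [b])) \<union> curves \<gamma> (path_edges (a # ws @ [b]))) \<union>
         inside (curves \<gamma> (path_edges (a # zs @ [b])) \<union> curves \<gamma> (path_edges (a # ws @ [b]))) \<union>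
         (curves \<gamma> (path_edges (a # ws @ [b])) - {f a, f b}) =
         inside (curves \<gamma> (path_edges (a # ys @ [b])) \<union> curves \<gamma> (path_edges (a # zs @ [b])))"
    using split_inside_simple_closed_curve[OF sp(1) c1(2,3) sp(2) c2(2,3) sp(3) c(2,3) ab I m]
    unfolding c1(4) c2(4) c(4) by blast+
qed

text \<open>Cut the cycle at its first two vertices and join the two arcs, which meet only in their
  ends, into a loop.\<close>

lemma cycle_curve:
  assumes "is_cycle E cs"
  obtains g where "simple_path g" "pathfinish g = pathstart g" "path_image g = curves \<gamma> (cycle_edges cs)"
proof -
  obtain a b rest where cs: "cs = a # b # rest" "a \<noteq> b"
    using assms unfolding is_cycle_def by (cases cs; cases "tl cs") auto
  obtain ys zs where yz: "distinct (a # b # ys @ zs)" "length cs = length ys + length zs + 2"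
    "cycle_edges cs = path_edges (a # ys @ [b]) \<union> path_edges (a # zs @ [b])"
    using cycle_split[of cs a b] assms cs unfolding is_cycle_def by (metis list.set_intros)
  have ne: "ys \<noteq> [] \<or> zs \<noteq> []" using yz(2) assms by (auto simp: is_cycle_def)
  have sub: "path_edges (a # ys @ [b]) \<subseteq> E" "path_edges (a # zs @ [b]) \<subseteq> E"
    using assms yz(3) by (auto simp: is_cycle_def)
  obtain g where g: "arc g" "pathstart g = f a" "pathfinish g = f b"
    "path_image g = curves \<gamma> (path_edges (a # ys @ [b]))" using path_arc[OF _ _ sub(1)] yz(1) by auto
  obtain h where h: "arc h" "pathstart h = f a" "pathfinish h = f b"
    "path_image h = curves \<gamma> (path_edges (a # zs @ [b]))" using path_arc[OF _ _ sub(2)] yz(1) by auto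
  have I: "path_image g \<inter> path_image h = {f a, f b}"
    unfolding g(4) h(4) by (rule two_paths_Int[OF yz(1) sub path_edges_disjoint[OF yz(1) ne]])
  have "simple_path (g +++ reversepath h)"
    using g h I by (intro simple_path_join_loop) (auto simp: arc_reversepath)
  then show ?thesis
    using g h yz(3) by (intro that[of "g +++ reversepath h"]) (auto simp: path_image_join)
qed

section \<open>Position of an edge relative to other curves\<close>

lemma edge_minus_ends_connected:
  assumes "e \<in> E" "A \<subseteq> f ` e"
  shows "connected (path_image (\<gamma> e) - A)"
proof -
  define J where "J = {t \<in> {0..1}. \<gamma> e t \<notin> A}"
  have ends': "f ` e = {\<gamma> e 0, \<gamma> e 1}" using ends[OF assms(1)] by (simp add: pathstart_def pathfinish_def)
  have injg: "inj_on (\<gamma> e) {0..1}" using arcs[OF assms(1)] by (simp add: arc_def)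
  have mid: "t \<in> J" if "0 < t" "t < 1" for t
  proof -
    have "\<gamma> e t \<noteq> \<gamma> e 0" "\<gamma> e t \<noteq> \<gamma> e 1" 
      using inj_onD[OF injg, of t 0] inj_onD[OF injg, of t 1] that by auto
    then show ?thesis using that assms(2) ends' by (auto simp: J_def)
  qed
  have J01: "0 \<le> t \<and> t \<le> 1" if "t \<in> J" for t using that by (simp add: J_def)
  \<comment> \<open>Every parameter strictly between 0 and 1 lies in \<open>J\<close>, because
    \<open>A\<close> contains at most the two ends. A parameter between two members of
    \<open>J\<close> is of this kind or equals one of them.\<close>
  have "is_interval J"
    unfolding is_interval_1
  proof (intro ballI allI impI)
    fix a b x assume ab: "a \<in> J" "b \<in> J" "a \<le> x \<and> x \<le> b"
    show "x \<in> J"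
    proof (cases "0 < x \<and> x < 1")
      case False
      then have "x = a \<or> x = b" using ab J01[of a] J01[of b] by linarith
      then show ?thesis using ab by blast
    qed (use mid in blast)
  qed
  then have "connected J" by (simp add: is_interval_connected)
  moreover have "continuous_on J (\<gamma> e)"
    using arcs[OF assms(1)] by (auto simp: J_def arc_def path_def intro: continuous_on_subset)
  ultimately have "connected (\<gamma> e ` J)" by (rule connected_continuous_image[rotated])
  moreover have "\<gamma> e ` J = path_image (\<gamma> e) - A" by (auto simp: J_def path_image_def)
  ultimately show ?thesis by simp
qed

text \<open>The curve at parameter 1/2 is such a point. It later tells on which side of a closed
  curve an edge runs, even if both ends lie on that curve.\<close>

lemma edge_minus_ends_nonempty:
  assumes "e \<in> E"
  shows "path_image (\<gamma> e) - f ` e \<noteq> {}"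
proof -
  have ends': "f ` e = {\<gamma> e 0, \<gamma> e 1}" using ends[OF assms] by (simp add: pathstart_def pathfinish_def)
  have injg: "inj_on (\<gamma> e) {0..1}" using arcs[OF assms] by (simp add: arc_def)
  have "\<gamma> e (1/2) \<noteq> \<gamma> e 0" "\<gamma> e (1/2) \<noteq> \<gamma> e 1"
    using inj_onD[OF injg, of "1/2" 0] inj_onD[OF injg, of "1/2" 1] by auto
  moreover have "\<gamma> e (1/2) \<in> path_image (\<gamma> e)" by (auto simp: path_image_def)
  ultimately show ?thesis using ends' by blast
qed

lemma edge_minus_disjoint:
  assumes "F \<subseteq> E" "e \<in> E - F"
  shows "(path_image (\<gamma> e) - f ` (e \<inter> \<Union>F)) \<inter> curves \<gamma> F = {}"
  using curves_Int_subset[of "{e}" F] assms by auto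

lemma edge_component:
  assumes "F \<subseteq> E" "e \<in> E - F" "x \<in> path_image (\<gamma> e) - curves \<gamma> F" "y \<in> path_image (\<gamma> e) - f ` (e \<inter> \<Union>F)"
  shows "connected_component (- curves \<gamma> F) x y"
proof -
  let ?S = "path_image (\<gamma> e) - f ` (e \<inter> \<Union>F)"
  have "connected ?S" using assms(2) by (intro edge_minus_ends_connected) auto
  moreover have "?S \<subseteq> - curves \<gamma> F" using edge_minus_disjoint[OF assms(1,2)] by blast
  moreover have "x \<in> ?S" using assms(3) ends_on_curves[OF assms(1)] by blast
  ultimately show ?thesis unfolding connected_component_def using assms(4) by (intro exI[of _ ?S] conjI)
qed

text \<open>Without its ends on \<open>F\<close>, the edge is connected and misses the curves of
  \<open>F\<close>, so it stays within one component of their complement.\<close>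

lemma edge_inside:
  assumes "F \<subseteq> E" "e \<in> E - F" "path_image (\<gamma> e) \<inter> inside (curves \<gamma> F) \<noteq> {}"
  shows "path_image (\<gamma> e) - f ` (e \<inter> \<Union>F) \<subseteq> inside (curves \<gamma> F)"
proof
  fix y assume y: "y \<in> path_image (\<gamma> e) - f ` (e \<inter> \<Union>F)"
  obtain x where x: "x \<in> path_image (\<gamma> e)" "x \<in> inside (curves \<gamma> F)" using assms(3) by blast
  have "x \<notin> curves \<gamma> F" using x(2) inside_no_overlap by blast
  then have "connected_component (- curves \<gamma> F) x y" using edge_component[OF assms(1,2) _ y] x(1) by blast
  then show "y \<in> inside (curves \<gamma> F)" using x(2) inside_same_component by blast
qed

lemma edge_outside:
  assumes "F \<subseteq> E" "e \<in> E - F" "path_image (\<gamma> e) \<inter> outside (curves \<gamma> F) \<noteq> {}"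
  shows "path_image (\<gamma> e) - f ` (e \<inter> \<Union>F) \<subseteq> outside (curves \<gamma> F)"
proof
  fix y assume y: "y \<in> path_image (\<gamma> e) - f ` (e \<inter> \<Union>F)"
  obtain x where x: "x \<in> path_image (\<gamma> e)" "x \<in> outside (curves \<gamma> F)" using assms(3) by blast
  have "x \<notin> curves \<gamma> F" using x(2) outside_no_overlap by blast
  then have "connected_component (- curves \<gamma> F) x y" using edge_component[OF assms(1,2) _ y] x(1) by blast
  then show "y \<in> outside (curves \<gamma> F)" using x(2) outside_same_component by blast
qed

end

section \<open>Edges inside a cycle\<close>

lemma notin_inside: "x \<in> S \<Longrightarrow> x \<notin> inside S"
  by (simp add: inside_def)

text \<open>One point inside suffices: by \<open>edge_inside\<close> such an edge runs inside except
  for its ends on the cycle. Chords drawn inside are included.\<close>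

definition inner_edges :: "'a set set \<Rightarrow> ('a set \<Rightarrow> real \<Rightarrow> complex) \<Rightarrow> 'a list \<Rightarrow> 'a set set" where
  "inner_edges E \<gamma> cs = {e \<in> E. path_image (\<gamma> e) \<inter> inside (curves \<gamma> (cycle_edges cs)) \<noteq> {}}"

definition inner_vertices :: "'a set \<Rightarrow> ('a \<Rightarrow> complex) \<Rightarrow> ('a set \<Rightarrow> real \<Rightarrow> complex) \<Rightarrow> 'a list \<Rightarrow> 'a set" where
  "inner_vertices V f \<gamma> cs = {v \<in> V. f v \<in> inside (curves \<gamma> (cycle_edges cs))}"

context plane_graph
begin

lemma finite_inner: "finite (inner_edges E \<gamma> cs)" "finite (inner_vertices V f \<gamma> cs)"
  using finite_E finite_V by (auto simp: inner_edges_def inner_vertices_def)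

lemma inner_edges_not_cycle: "inner_edges E \<gamma> cs \<inter> cycle_edges cs = {}"
proof -
  have "path_image (\<gamma> e) \<inter> inside (curves \<gamma> (cycle_edges cs)) = {}" if "e \<in> cycle_edges cs" for e
  proof -
    have "path_image (\<gamma> e) \<subseteq> curves \<gamma> (cycle_edges cs)" using that by (auto simp: curves_def)
    then show ?thesis using notin_inside by blast
  qed
  then show ?thesis by (auto simp: inner_edges_def)
qed

lemma inner_edge_ends:
  assumes "is_cycle E cs" "e \<in> inner_edges E \<gamma> cs"
  shows "e \<subseteq> inner_vertices V f \<gamma> cs \<union> set cs"
proof
  fix v assume v: "v \<in> e"
  have F: "cycle_edges cs \<subseteq> E" and ne: "cs \<noteq> []" using assms(1) by (auto simp: is_cycle_def)
  have e: "e \<in> E - cycle_edges cs" using assms(2) inner_edges_not_cycle by (auto simp: inner_edges_def)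
  have vV: "v \<in> V" using e v edge_subset by blast
  show "v \<in> inner_vertices V f \<gamma> cs \<union> set cs"
  proof (cases "v \<in> set cs")
    case False
    have "f v \<notin> curves \<gamma> (cycle_edges cs)"
      using vertex_on_curves[OF F vV] Union_cycle_edges[OF ne] False by simp
    then have "f v \<in> path_image (\<gamma> e) - f ` (e \<inter> \<Union>(cycle_edges cs))"
      using e v ends_on_curve[of e] ends_on_curves[OF F] by blast
    then have "f v \<in> inside (curves \<gamma> (cycle_edges cs))"
      using edge_inside[OF F e] assms(2) by (auto simp: inner_edges_def)
    then show ?thesis using vV by (simp add: inner_vertices_def)
  qed simp
qed

lemma edge_at_inner_vertex:
  assumes "e \<in> E" "v \<in> e" "v \<in> inner_vertices V f \<gamma> cs"
  shows "e \<in> inner_edges E \<gamma> cs"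
  using assms ends_on_curve[of e] by (auto simp: inner_edges_def inner_vertices_def)

lemma inner_vertices_not_cycle:
  assumes "is_cycle E cs"
  shows "inner_vertices V f \<gamma> cs \<inter> set cs = {}"
proof -
  have F: "cycle_edges cs \<subseteq> E" and ne: "cs \<noteq> []" using assms by (auto simp: is_cycle_def)
  have "f v \<in> curves \<gamma> (cycle_edges cs)" if "v \<in> set cs" for v
    using ends_on_curves[OF F] Union_cycle_edges[OF ne] that by auto
  then show ?thesis using notin_inside by (fastforce simp: inner_vertices_def)
qed

text \<open>The path \<open>ws\<close> and the two halves of the cycle form a theta curve;
  \<open>c1\<close> and \<open>c2\<close> consist of one half and the path. The path may be a chord,
  with \<open>ws\<close> empty.\<close>

lemma inner_path_splits:
  assumes C: "is_cycle E cs" and a: "a \<in> set cs" and b: "b \<in> set cs" "a \<noteq> b"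
    and ws: "distinct ws" "set ws \<subseteq> inner_vertices V f \<gamma> cs" "path_edges (a # ws @ [b]) \<subseteq> inner_edges E \<gamma> cs"
  obtains c1 c2 where "is_cycle E c1" "is_cycle E c2"
    "length c1 + length c2 = length cs + 2 * length ws + 2"
    "inner_edges E \<gamma> cs \<subseteq> inner_edges E \<gamma> c1 \<union> inner_edges E \<gamma> c2 \<union> path_edges (a # ws @ [b])"
    "inner_edges E \<gamma> c1 \<subset> inner_edges E \<gamma> cs" "inner_edges E \<gamma> c2 \<subset> inner_edges E \<gamma> cs"
    "inner_vertices V f \<gamma> c1 \<union> inner_vertices V f \<gamma> c2 \<union> set ws \<subseteq> inner_vertices V f \<gamma> cs"
    "inner_vertices V f \<gamma> c1 \<inter> inner_vertices V f \<gamma> c2 = {}"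
    "(inner_vertices V f \<gamma> c1 \<union> inner_vertices V f \<gamma> c2) \<inter> set ws = {}"
proof -
  have F: "cycle_edges cs \<subseteq> E" and dcs: "distinct cs" "3 \<le> length cs" using C by (auto simp: is_cycle_def)
  obtain ys zs where yz: "distinct (a # b # ys @ zs)" "set cs = insert a (insert b (set ys \<union> set zs))"
    "length cs = length ys + length zs + 2"
    "cycle_edges cs = path_edges (a # ys @ [b]) \<union> path_edges (a # zs @ [b])"
    using cycle_split[OF dcs a b] by metis
  let ?Y = "path_edges (a # ys @ [b])" and ?Z = "path_edges (a # zs @ [b])" and ?W = "path_edges (a # ws @ [b])"
  have ne: "ys \<noteq> [] \<or> zs \<noteq> []" using yz(3) dcs(2) by auto
  have wsC: "set ws \<inter> set cs = {}" using ws(2) inner_vertices_not_cycle[OF C] by blast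
  have d: "distinct (a # b # ys @ zs @ ws)" using yz(1,2) ws(1) wsC by auto
  have subE: "?Y \<subseteq> E" "?Z \<subseteq> E" "?W \<subseteq> E" using F yz(4) ws(3) by (auto simp: inner_edges_def)
  have disj: "?Y \<inter> ?Z = {}" "?Y \<inter> ?W = {}" "?Z \<inter> ?W = {}"
    using path_edges_disjoint[OF yz(1) ne] inner_edges_not_cycle[of cs] yz(4) ws(3) by blast+
  have "a \<in> V" "b \<in> V"
  proof -
    have "\<Union>?Y = set (a # ys @ [b])" by (rule Union_path_edges) simp
    then have "{a, b} \<subseteq> \<Union>?Y" by simp
    also have "\<dots> \<subseteq> V" using subE(1) edge_subset by blast
    finally show "a \<in> V" "b \<in> V" by auto
  qed
  then have fab: "f a \<noteq> f b" using inj b(2) by (auto simp: inj_on_def)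
  have CU: "curves \<gamma> (cycle_edges cs) = curves \<gamma> ?Y \<union> curves \<gamma> ?Z" using yz(4) by simp
  have W0: "\<exists>e. e \<in> ?W" by (cases ws) auto
  have meets: "curves \<gamma> ?W \<inter> inside (curves \<gamma> ?Y \<union> curves \<gamma> ?Z) \<noteq> {}"
  proof -
    obtain e where e: "e \<in> ?W" using W0 by blast
    then have "path_image (\<gamma> e) \<inter> inside (curves \<gamma> (cycle_edges cs)) \<noteq> {}"
      using ws(3) by (auto simp: inner_edges_def)
    then show ?thesis unfolding CU using e by (auto simp: curves_def)
  qed
  note th = theta[OF d subE disj fab meets]
  define c1 where "c1 = a # ys @ b # rev ws"
  define c2 where "c2 = a # zs @ b # rev ws"
  have ce: "cycle_edges c1 = ?Y \<union> ?W" "cycle_edges c2 = ?Z \<union> ?W"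
    by (simp_all add: c1_def c2_def cycle_edges_two_paths)
  \<comment> \<open>Otherwise the edge from \<open>a\<close> to \<open>b\<close> would belong both
    to the cycle and to the inner path.\<close>
  have n1: "ys \<noteq> [] \<or> ws \<noteq> []"
  proof (rule ccontr)
    assume "\<not> ?thesis"
    then have "{a, b} \<in> ?Y \<inter> ?W" by simp
    then show False using disj(2) by blast
  qed
  have n2: "zs \<noteq> [] \<or> ws \<noteq> []"
  proof (rule ccontr)
    assume "\<not> ?thesis"
    then have "{a, b} \<in> ?Z \<inter> ?W" by simp
    then show False using disj(3) by blast
  qed
  have c1: "is_cycle E c1" unfolding c1_def
    by (rule is_cycle_two_paths) (use d n1 subE in auto)
  have c2: "is_cycle E c2" unfolding c2_def
    by (rule is_cycle_two_paths) (use d n2 subE in auto)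
  have len: "length c1 + length c2 = length cs + 2 * length ws + 2"
    using yz(3) by (simp add: c1_def c2_def)
  let ?I = "inside (curves \<gamma> (cycle_edges cs))" and ?I1 = "inside (curves \<gamma> (cycle_edges c1))"
    and ?I2 = "inside (curves \<gamma> (cycle_edges c2))"
  have I12: "?I1 \<inter> ?I2 = {}" using th(1) ce by simp
  have IU: "?I = ?I1 \<union> ?I2 \<union> (curves \<gamma> ?W - {f a, f b})" using th(2) ce CU by simp
  have IW: "?I1 \<inter> curves \<gamma> ?W = {}" "?I2 \<inter> curves \<gamma> ?W = {}"
    unfolding ce curves_simps using notin_inside by blast+
  have cov: "inner_edges E \<gamma> cs \<subseteq> inner_edges E \<gamma> c1 \<union> inner_edges E \<gamma> c2 \<union> ?W"
  proof
    fix e assume e: "e \<in> inner_edges E \<gamma> cs"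
    show "e \<in> inner_edges E \<gamma> c1 \<union> inner_edges E \<gamma> c2 \<union> ?W"
    proof (cases "e \<in> ?W")
      case False
      have eC: "e \<in> E - cycle_edges cs" using e inner_edges_not_cycle by (auto simp: inner_edges_def)
      then have eE: "e \<in> E" by simp
      have "path_image (\<gamma> e) - f ` (e \<inter> \<Union>(cycle_edges cs)) \<subseteq> ?I"
        using edge_inside[OF F eC] e by (simp add: inner_edges_def)
      \<comment> \<open>A point of the edge other than its ends lies inside the big cycle and off
        the dividing path, hence inside one of the two smaller cycles.\<close>
      moreover obtain z where z: "z \<in> path_image (\<gamma> e)" "z \<notin> f ` e"
        using edge_minus_ends_nonempty[OF eE] by blast
      moreover have "z \<notin> curves \<gamma> ?W"
        using edge_minus_disjoint[OF subE(3), of e] False eE z by blast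
      ultimately have "z \<in> ?I1 \<union> ?I2" using IU by blast
      then show ?thesis using z eE by (auto simp: inner_edges_def)
    qed simp
  qed
  have W1: "e \<notin> inner_edges E \<gamma> c1 \<and> e \<notin> inner_edges E \<gamma> c2" if "e \<in> ?W" for e
    using that inner_edges_not_cycle[of c1] inner_edges_not_cycle[of c2] ce by blast
  have sub12: "inner_edges E \<gamma> c1 \<subseteq> inner_edges E \<gamma> cs" "inner_edges E \<gamma> c2 \<subseteq> inner_edges E \<gamma> cs"
    using IU by (auto simp: inner_edges_def)
  \<comment> \<open>The edges of the dividing path are inner edges of \<open>cs\<close> but belong
    to both new cycles. They exist even if \<open>ws\<close> is empty, so the inner edge sets really
    shrink.\<close>
  have strict: "inner_edges E \<gamma> c1 \<subset> inner_edges E \<gamma> cs" "inner_edges E \<gamma> c2 \<subset> inner_edges E \<gamma> cs"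
    using sub12 W0 W1 ws(3) by blast+
  have vs: "inner_vertices V f \<gamma> c1 \<union> inner_vertices V f \<gamma> c2 \<union> set ws \<subseteq> inner_vertices V f \<gamma> cs"
    using IU ws(2) by (auto simp: inner_vertices_def)
  have v12: "inner_vertices V f \<gamma> c1 \<inter> inner_vertices V f \<gamma> c2 = {}" using I12 by (auto simp: inner_vertices_def)
  have "f w \<in> curves \<gamma> ?W" if "w \<in> set ws" for w
  proof -
    have "\<Union>?W = set (a # ws @ [b])" by (rule Union_path_edges) simp
    then show ?thesis using ends_on_curves[OF subE(3)] that by auto
  qed
  then have vw: "(inner_vertices V f \<gamma> c1 \<union> inner_vertices V f \<gamma> c2) \<inter> set ws = {}"
    using IW by (auto simp: inner_vertices_def)
  show ?thesis by (rule that[OF c1 c2 len cov strict vs v12 vw])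
qed

end

text \<open>Induction on the number of inner edges and vertices. \<open>IHM\<close> is the induction
  hypothesis of the later global edge bound; \<open>M\<close> is kept apart from
  \<open>card V\<close> so that it survives the removal of vertices.\<close>

lemma disc_bound:
  assumes "plane_graph V E f \<gamma>" "is_cycle E cs" "card V \<le> M"
    and IHM: "\<And>V' E'. plane_graph V' E' f \<gamma> \<Longrightarrow> V' \<noteq> {} \<Longrightarrow> card V' < M \<Longrightarrow> card E' + 3 \<le> 3 * card V'"
  shows "card (inner_edges E \<gamma> cs) + 3 \<le> 3 * card (inner_vertices V f \<gamma> cs) + length cs"
  using assms(1-3)
proof (induction "card (inner_edges E \<gamma> cs) + card (inner_vertices V f \<gamma> cs)"
    arbitrary: V E cs rule: less_induct)
  case less
  interpret plane_graph V E f \<gamma> by fact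
  note C = \<open>is_cycle E cs\<close>
  have F: "cycle_edges cs \<subseteq> E" and cs0: "cs \<noteq> []" and dcs: "distinct cs" "3 \<le> length cs"
    using C by (auto simp: is_cycle_def)
  let ?D = "inner_edges E \<gamma> cs" and ?I = "inner_vertices V f \<gamma> cs"
  have csV: "set cs \<subseteq> V" using Union_cycle_edges[OF cs0] F edge_subset by blast
  show ?case
  proof (cases "\<exists>a b ws. a \<in> set cs \<and> b \<in> set cs \<and> a \<noteq> b \<and> distinct ws \<and> set ws \<subseteq> ?I \<and>
      path_edges (a # ws @ [b]) \<subseteq> ?D")
    case True
    then obtain a b ws where w: "a \<in> set cs" "b \<in> set cs" "a \<noteq> b" "distinct ws" "set ws \<subseteq> ?I"
      "path_edges (a # ws @ [b]) \<subseteq> ?D" by blast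
    obtain c1 c2 where c: "is_cycle E c1" "is_cycle E c2"
      "length c1 + length c2 = length cs + 2 * length ws + 2"
      "?D \<subseteq> inner_edges E \<gamma> c1 \<union> inner_edges E \<gamma> c2 \<union> path_edges (a # ws @ [b])"
      "inner_edges E \<gamma> c1 \<subset> ?D" "inner_edges E \<gamma> c2 \<subset> ?D"
      "inner_vertices V f \<gamma> c1 \<union> inner_vertices V f \<gamma> c2 \<union> set ws \<subseteq> ?I"
      "inner_vertices V f \<gamma> c1 \<inter> inner_vertices V f \<gamma> c2 = {}"
      "(inner_vertices V f \<gamma> c1 \<union> inner_vertices V f \<gamma> c2) \<inter> set ws = {}"
      using inner_path_splits[OF C w] by metis
    have lt: "card (inner_edges E \<gamma> c1) < card ?D" "card (inner_edges E \<gamma> c2) < card ?D"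
      using c(5,6) finite_inner psubset_card_mono by metis+
    have le: "card (inner_vertices V f \<gamma> c1) \<le> card ?I" "card (inner_vertices V f \<gamma> c2) \<le> card ?I"
      using c(7) finite_inner by (auto intro!: card_mono)
    have 1: "card (inner_edges E \<gamma> c1) + 3 \<le> 3 * card (inner_vertices V f \<gamma> c1) + length c1"
      using less.hyps[OF _ less.prems(1) c(1) less.prems(3)] lt(1) le(1) by linarith
    have 2: "card (inner_edges E \<gamma> c2) + 3 \<le> 3 * card (inner_vertices V f \<gamma> c2) + length c2"
      using less.hyps[OF _ less.prems(1) c(2) less.prems(3)] lt(2) le(2) by linarith
    have "card ?D \<le> card (inner_edges E \<gamma> c1 \<union> inner_edges E \<gamma> c2 \<union> path_edges (a # ws @ [b]))"
      using c(4) finite_inner by (intro card_mono) auto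
    also have "\<dots> \<le> card (inner_edges E \<gamma> c1) + card (inner_edges E \<gamma> c2) + card (path_edges (a # ws @ [b]))"
      by (meson add_le_mono card_Un_le le_trans order_refl)
    also have "\<dots> \<le> card (inner_edges E \<gamma> c1) + card (inner_edges E \<gamma> c2) + (length ws + 1)"
      using card_path_edges_le[of "a # ws @ [b]"] by simp
    finally have 3: "card ?D \<le> card (inner_edges E \<gamma> c1) + card (inner_edges E \<gamma> c2) + (length ws + 1)" .
    have "card (inner_vertices V f \<gamma> c1) + card (inner_vertices V f \<gamma> c2) + length ws =
        card (inner_vertices V f \<gamma> c1 \<union> inner_vertices V f \<gamma> c2 \<union> set ws)"
      using c(8,9) finite_inner w(4) by (simp add: card_Un_disjoint distinct_card)
    also have "\<dots> \<le> card ?I" using c(7) finite_inner by (intro card_mono) auto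
    finally have 4: "card (inner_vertices V f \<gamma> c1) + card (inner_vertices V f \<gamma> c2) + length ws \<le> card ?I" .
    \<comment> \<open>With w inner vertices on the path, the two bounds and the w+1 path edges add
      up to 3(i1+i2) + (k+2w+2) - 6 + (w+1) = 3(i1+i2+w) + k - 3.\<close>
    show ?thesis using 1 2 3 4 c(3) by linarith
  next
    case False
    then have nopath: "\<And>a b ws. a \<in> set cs \<Longrightarrow> b \<in> set cs \<Longrightarrow> a \<noteq> b \<Longrightarrow> distinct ws \<Longrightarrow>
      set ws \<subseteq> ?I \<Longrightarrow> path_edges (a # ws @ [b]) \<subseteq> ?D \<Longrightarrow> False" by blast
    show ?thesis
    proof (cases "?I = {}")
      case True
      \<comment> \<open>Without inner vertices an inner edge would be a chord, that is, an excluded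
        path with \<open>ws\<close> empty.\<close>
      have "?D = {}"
      proof (rule ccontr)
        assume "?D \<noteq> {}"
        then obtain e where e: "e \<in> ?D" by blast
        then obtain u v where uv: "u \<noteq> v" "e = {u, v}"
          using G unfolding simple_graph_def inner_edges_def by blast
        have "u \<in> set cs" "v \<in> set cs" using inner_edge_ends[OF C e] True uv by auto
        then show False using nopath[of u v "[]"] uv e by simp
      qed
      then show ?thesis using dcs(2) True by simp
    next
      case False
      then obtain v where v: "v \<in> ?I" by blast
      \<comment> \<open>\<open>K\<close> is the component of \<open>v\<close> in the graph of inner
        vertices and inner edges, and \<open>At\<close> collects the vertices of the cycle to which
        it is attached.\<close>
      define R where "R = {(x, y). x \<in> ?I \<and> y \<in> ?I \<and> {x, y} \<in> ?D}"
      define K where "K = {y. (v, y) \<in> R\<^sup>*}"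
      have "sym R" by (auto simp: R_def sym_def insert_commute)
      have vK: "v \<in> K" by (simp add: K_def)
      have KI: "K \<subseteq> ?I"
      proof
        fix y assume "y \<in> K"
        then have "(v, y) \<in> R\<^sup>*" by (simp add: K_def)
        then show "y \<in> ?I" by (cases rule: rtranclE) (use v in \<open>auto simp: R_def\<close>)
      qed
      define EK where "EK = {e \<in> E. e \<inter> K \<noteq> {}}"
      define At where "At = {c \<in> set cs. \<exists>x\<in>K. {x, c} \<in> ?D}"
      have EKD: "EK \<subseteq> ?D" using edge_at_inner_vertex KI by (auto simp: EK_def)
      \<comment> \<open>Two attachment vertices could be linked by a path through the connected set
        \<open>K\<close>, which is the excluded case.\<close>
      have At1: "c = c'" if cA: "c \<in> At" "c' \<in> At" for c c'
      proof (rule ccontr)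
        assume "c \<noteq> c'"
        obtain x x' where x: "x \<in> K" "{x, c} \<in> ?D" "x' \<in> K" "{x', c'} \<in> ?D"
          using cA unfolding At_def by blast
        have "(x, v) \<in> R\<^sup>*" "(v, x') \<in> R\<^sup>*"
          using x \<open>sym R\<close> by (auto simp: K_def intro: symD[OF sym_rtrancl])
        then have xx': "(x, x') \<in> R\<^sup>*" by (rule rtrancl_trans)
        have xI: "x \<in> ?I" using x KI by blast
        have "\<exists>ws. ws \<noteq> [] \<and> hd ws = x \<and> last ws = x' \<and> distinct ws \<and> set ws \<subseteq> ?I \<and> path_edges ws \<subseteq> ?D"
          by (rule rtrancl_path[OF xx' xI]) (simp add: R_def)
        then obtain ws where ws: "ws \<noteq> []" "hd ws = x" "last ws = x'" "distinct ws"
          "set ws \<subseteq> ?I" "path_edges ws \<subseteq> ?D" by blast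
        have "{c, x} \<in> ?D" using x(2) by (simp add: insert_commute)
        then have "path_edges (c # ws @ [c']) \<subseteq> ?D"
          using ws x(4) by (simp add: path_edges_Cons path_edges_snoc)
        then show False using nopath[of c c' ws] cA \<open>c \<noteq> c'\<close> ws by (auto simp: At_def)
      qed
      have finA: "finite At" by (simp add: At_def)
      have "card At \<le> Suc 0" using At1 finA card_le_Suc0_iff_eq by blast
      have finK: "finite K" using KI finite_inner finite_subset by blast
      have KA: "e \<subseteq> K \<union> At" if e: "e \<in> EK" for e
      proof -
        have eD: "e \<in> ?D" using e EKD by blast
        obtain x where x: "x \<in> e" "x \<in> K" using e by (auto simp: EK_def)
        obtain y where y: "e = {x, y}"
          using G eD x(1) by (fastforce simp: simple_graph_def inner_edges_def)
        have "y \<in> ?I \<or> y \<in> set cs" using inner_edge_ends[OF C eD] y by auto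
        then have "y \<in> K \<or> y \<in> At"
        proof
          assume "y \<in> ?I"
          then have "(x, y) \<in> R" using x(2) KI eD y by (auto simp: R_def)
          then show ?thesis using x(2) by (auto simp: K_def intro: rtrancl.rtrancl_into_rtrancl)
        next
          assume "y \<in> set cs"
          then show ?thesis using x(2) eD y by (auto simp: At_def)
        qed
        then show ?thesis using x y by auto
      qed
      have IV: "?I \<subseteq> V" by (auto simp: inner_vertices_def)
      have KAV: "K \<union> At \<subseteq> V" using KI IV csV by (auto simp: At_def)
      have H: "plane_graph (K \<union> At) EK f \<gamma>"
        by (rule plane_graph_subgraph[OF less.prems(1) KAV]) (use KA in \<open>auto simp: EK_def\<close>)
      have dis: "?I \<inter> set cs = {}" by (rule inner_vertices_not_cycle[OF C])
      have cKA: "card (K \<union> At) \<le> card K + 1"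
        using card_Un_le[of K At] \<open>card At \<le> Suc 0\<close> by linarith
      have "card K + 3 \<le> card K + card (set cs)" using dcs(2) distinct_card[OF dcs(1)] by linarith
      also have "\<dots> = card (K \<union> set cs)"
        using KI dis finK by (subst card_Un_disjoint) auto
      also have "\<dots> \<le> card V" using KI IV csV finite_V by (intro card_mono) auto
      \<comment> \<open>The cycle has at least three vertices and at most one of them is in
        \<open>At\<close>, so the global bound applies to the piece. It gives
        \<open>card EK + 3\<close> \<le> 3(\<open>card K\<close> + 1), hence at most 3 edges per
        vertex of \<open>K\<close>.\<close>
      finally have "card (K \<union> At) < M" using cKA less.prems(3) by linarith
      then have "card EK + 3 \<le> 3 * card (K \<union> At)" using IHM[OF H] vK by blast
      then have cEK: "card EK \<le> 3 * card K" using cKA by linarith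
      \<comment> \<open>Removing \<open>K\<close> leaves the cycle and its inside unchanged and
        lowers both sides of the bound compatibly.\<close>
      define E' where "E' = {e \<in> E. e \<inter> K = {}}"
      have G': "plane_graph (V - K) E' f \<gamma>"
        by (rule plane_graph_subgraph[OF less.prems(1)]) (use edge_subset in \<open>auto simp: E'_def\<close>)
      have "cycle_edges cs \<subseteq> E'"
      proof
        fix e assume e: "e \<in> cycle_edges cs"
        then have "e \<subseteq> set cs" using Union_cycle_edges[OF cs0] by blast
        then show "e \<in> E'" using e F KI dis by (auto simp: E'_def)
      qed
      then have C': "is_cycle E' cs" using dcs by (simp add: is_cycle_def)
      have D': "inner_edges E' \<gamma> cs = ?D - EK"
        by (auto simp: inner_edges_def E'_def EK_def)
      have I': "inner_vertices (V - K) f \<gamma> cs = ?I - K"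
        by (auto simp: inner_vertices_def)
      have finEK: "finite EK" using EKD finite_inner finite_subset by blast
      have cD: "card ?D = card (?D - EK) + card EK"
        using EKD finEK finite_inner(1)[of cs] by (simp add: card_Diff_subset card_mono)
      have cI: "card ?I = card (?I - K) + card K"
        using KI finK finite_inner(2)[of cs] by (simp add: card_Diff_subset card_mono)
      have "card K > 0" using vK finK by (auto simp: card_gt_0_iff)
      then have "card (inner_edges E' \<gamma> cs) + card (inner_vertices (V - K) f \<gamma> cs) < card ?D + card ?I"
        using cD cI D' I' by simp
      moreover have "card (V - K) \<le> M" using less.prems(3) card_mono[of V "V - K"] finite_V by auto
      ultimately have "card (inner_edges E' \<gamma> cs) + 3 \<le> 3 * card (inner_vertices (V - K) f \<gamma> cs) + length cs"
        using less.hyps[OF _ G' C'] by blast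
      then show ?thesis using D' I' cD cI cEK by simp
    qed
  qed
qed

section \<open>Edges of a planar graph\<close>

text \<open>A component of the complement of the image that contains an image of an outside point is
  carried back outside \<open>S\<close>, hence away from a ball around \<open>p\<close>. Points far
  from 0 would be carried into that ball, so the component is bounded.\<close>

lemma outside_inversion:
  fixes S :: "complex set"
  assumes "compact S" "p \<in> inside S" "x \<in> outside S"
  shows "1 / (x - p) \<in> inside ((\<lambda>z. 1 / (z - p)) ` S)"
proof -
  let ?\<phi> = "\<lambda>z. 1 / (z - p)" and ?\<psi> = "\<lambda>w. p + 1 / w"
  have pS: "p \<notin> S" using assms(2) notin_inside by blast
  have xp: "x \<noteq> p" using assms(2,3) inside_Int_outside by blast
  have xS: "x \<notin> S" using assms(3) outside_no_overlap by blast
  \<comment> \<open>This holds at z = p as well, since 1/0 = 0.\<close>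
  have inv: "?\<psi> (?\<phi> z) = z" for z by simp
  have inv2: "?\<phi> (?\<psi> w) = w" for w by simp
  obtain r where r: "r > 0" "ball p r \<subseteq> inside S"
    using open_inside[OF compact_imp_closed[OF assms(1)]] assms(2) open_contains_ball by blast
  have ne: "?\<phi> x \<notin> ?\<phi> ` S"
  proof
    assume "?\<phi> x \<in> ?\<phi> ` S"
    then obtain z where "z \<in> S" "?\<phi> x = ?\<phi> z" by blast
    then have "x = z" using inv by metis
    then show False using xS \<open>z \<in> S\<close> by simp
  qed
  define K where "K = connected_component_set (- ?\<phi> ` S) (?\<phi> x)"
  have phi_cont: "continuous_on S ?\<phi>" using pS by (intro continuous_intros) auto
  have "bounded K"
  proof -
    have psi_K: "?\<psi> w \<in> - S" if "w \<in> K - {0}" for w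
    proof
      assume "?\<psi> w \<in> S"
      then have "w \<in> ?\<phi> ` S" using inv2 by (metis imageI)
      moreover have "w \<in> - ?\<phi> ` S" using that connected_component_subset unfolding K_def by blast
      ultimately show False by blast
    qed
    have "compact (?\<phi> ` S)" using phi_cont assms(1) by (rule compact_continuous_image)
    then have "open K" unfolding K_def by (intro open_connected_component open_Compl compact_imp_closed)
    moreover have "connected K" by (simp add: K_def)
    \<comment> \<open>0 corresponds to the point at infinity, where \<open>?\<psi>\<close> is not
      continuous. Deleting one point from an open connected planar set keeps it connected.\<close>
    ultimately have "connected (K - {0})" by (intro connected_open_delete) auto
    then have "connected (?\<psi> ` (K - {0}))"
      by (intro connected_continuous_image continuous_intros) auto
    moreover have "?\<phi> x \<in> K" using ne by (simp add: K_def)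
    then have "x \<in> ?\<psi> ` (K - {0})" using inv[of x] xp by (intro image_eqI[of _ _ "?\<phi> x"]) auto
    ultimately have "?\<psi> ` (K - {0}) \<subseteq> connected_component_set (- S) x"
      using psi_K by (intro connected_component_maximal) auto
    then have out: "?\<psi> w \<in> outside S" if "w \<in> K - {0}" for w
      using that outside_same_component[OF _ assms(3)] by auto
    have "norm w \<le> 1 / r" if w: "w \<in> K - {0}" for w
    proof -
      have "?\<psi> w \<notin> ball p r" using out[OF w] r(2) inside_Int_outside by blast
      then have "r \<le> norm (1 / w)" by (simp add: dist_norm)
      then show ?thesis using w r(1) by (simp add: norm_divide field_simps)
    qed
    then have "norm w \<le> 1 / r" if "w \<in> K" for w using that r(1) by (cases "w = 0") auto
    then show ?thesis by (auto simp: bounded_iff)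
  qed
  then show ?thesis using ne by (simp add: inside_def K_def)
qed

text \<open>The map is injective, and continuous off \<open>p\<close>, so arcs and their
  intersections carry over to the image.\<close>

lemma plane_graph_inversion:
  assumes "plane_graph V E f \<gamma>" "p \<notin> f ` V" "p \<notin> curves \<gamma> E"
  shows "plane_graph V E (\<lambda>v. 1 / (f v - p)) (\<lambda>e t. 1 / (\<gamma> e t - p))"
proof -
  interpret plane_graph V E f \<gamma> by fact
  let ?\<phi> = "\<lambda>z::complex. 1 / (z - p)"
  have inv: "p + 1 / ?\<phi> z = z" for z by simp
  have inj\<phi>: "?\<phi> z = ?\<phi> z' \<Longrightarrow> z = z'" for z z' using inv by metis
  have pi: "path_image (\<lambda>t. ?\<phi> (\<gamma> e t)) = ?\<phi> ` path_image (\<gamma> e)" for e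
    by (auto simp: path_image_def)
  have np: "p \<notin> path_image (\<gamma> e)" if "e \<in> E" for e using assms(3) that by (auto simp: curves_def)
  show ?thesis
  proof
    show "simple_graph V E" by (rule G)
    show "inj_on (\<lambda>v. ?\<phi> (f v)) V"
    proof (rule inj_onI)
      fix u v assume "u \<in> V" "v \<in> V" "?\<phi> (f u) = ?\<phi> (f v)"
      then show "u = v" using inj_onD[OF inj] inj\<phi>[of "f u" "f v"] by blast
    qed
    show "arc (\<lambda>t. ?\<phi> (\<gamma> e t))" if e: "e \<in> E" for e
    proof -
      have "continuous_on (path_image (\<gamma> e)) ?\<phi>" using np[OF e] by (intro continuous_intros) auto
      then have "path (?\<phi> \<circ> \<gamma> e)" using arcs[OF e] by (intro path_continuous_image) (auto simp: arc_def)
      moreover have "inj_on (\<lambda>t. ?\<phi> (\<gamma> e t)) {0..1}"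
      proof (rule inj_onI)
        fix t u :: real assume tu: "t \<in> {0..1}" "u \<in> {0..1}" "?\<phi> (\<gamma> e t) = ?\<phi> (\<gamma> e u)"
        have "inj_on (\<gamma> e) {0..1}" using arcs[OF e] by (simp add: arc_def)
        from inj_onD[OF this inj\<phi>[OF tu(3)] tu(1,2)] show "t = u" .
      qed
      ultimately show ?thesis by (simp add: arc_def o_def)
    qed
    show "{pathstart (\<lambda>t. ?\<phi> (\<gamma> e t)), pathfinish (\<lambda>t. ?\<phi> (\<gamma> e t))} = (\<lambda>v. ?\<phi> (f v)) ` e" if "e \<in> E" for e
    proof -
      have "{pathstart (\<lambda>t. ?\<phi> (\<gamma> e t)), pathfinish (\<lambda>t. ?\<phi> (\<gamma> e t))} =
          ?\<phi> ` {pathstart (\<gamma> e), pathfinish (\<gamma> e)}" by (simp add: pathstart_def pathfinish_def)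
      then show ?thesis unfolding ends[OF that] by (simp add: image_image)
    qed
    show "v \<in> e" if ev: "e \<in> E" "v \<in> V" "?\<phi> (f v) \<in> path_image (\<lambda>t. ?\<phi> (\<gamma> e t))" for e v
    proof -
      obtain z where "z \<in> path_image (\<gamma> e)" "?\<phi> (f v) = ?\<phi> z" using ev(3) unfolding pi by blast
      then show ?thesis using avoid[OF ev(1,2)] inj\<phi> by metis
    qed
    show "path_image (\<lambda>t. ?\<phi> (\<gamma> e t)) \<inter> path_image (\<lambda>t. ?\<phi> (\<gamma> e' t)) \<subseteq> (\<lambda>v. ?\<phi> (f v)) ` (e \<inter> e')"
      if ee: "e \<in> E" "e' \<in> E" "e \<noteq> e'" for e e'
    proof
      fix w assume "w \<in> path_image (\<lambda>t. ?\<phi> (\<gamma> e t)) \<inter> path_image (\<lambda>t. ?\<phi> (\<gamma> e' t))"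
      then obtain z z' where z: "z \<in> path_image (\<gamma> e)" "z' \<in> path_image (\<gamma> e')" "w = ?\<phi> z" "w = ?\<phi> z'"
        unfolding pi by blast
      then have "z = z'" using inj\<phi> by metis
      then have "z \<in> f ` (e \<inter> e')" using cross[OF ee] z by blast
      then show "w \<in> (\<lambda>v. ?\<phi> (f v)) ` (e \<inter> e')" using z(3) by blast
    qed
  qed
qed

text \<open>Apply the disc bound inside the cycle, and once more to the inverted outside.
  \<open>IHM\<close> ranges over all drawings because inversion changes the drawing.\<close>

lemma (in plane_graph) cycle_bound:
  assumes C: "is_cycle E cs"
    and IHM: "\<And>(V' :: 'a set) E' f \<gamma>. plane_graph V' E' f \<gamma> \<Longrightarrow> V' \<noteq> {} \<Longrightarrow> card V' < card V \<Longrightarrow> card E' + 3 \<le> 3 * card V'"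
  shows "card E + 6 \<le> 3 * card V"
proof -
  let ?C = "curves \<gamma> (cycle_edges cs)"
  have PG: "plane_graph V E f \<gamma>" by unfold_locales
  have F: "cycle_edges cs \<subseteq> E" and cs0: "cs \<noteq> []" and dcs: "distinct cs" "3 \<le> length cs"
    using C by (auto simp: is_cycle_def)
  have csV: "set cs \<subseteq> V" using Union_cycle_edges[OF cs0] F edge_subset by blast
  obtain g where g: "simple_path g" "pathfinish g = pathstart g" "path_image g = ?C"
    using cycle_curve[OF C] by blast
  have "inside ?C \<noteq> {}" using Jordan_inside_outside[OF g(1,2)] g(3) by simp
  then obtain p where p: "p \<in> inside ?C" by blast
  have compactC: "compact ?C" using g compact_simple_path_image by metis
  define Vo where "Vo = {v \<in> V. f v \<in> outside ?C}"
  define Eo where "Eo = {e \<in> E. path_image (\<gamma> e) \<inter> outside ?C \<noteq> {}}"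
  have Eo_not: "Eo \<inter> cycle_edges cs = {}"
  proof -
    have "path_image (\<gamma> e) \<inter> outside ?C = {}" if "e \<in> cycle_edges cs" for e
    proof -
      have "path_image (\<gamma> e) \<subseteq> ?C" using that by (auto simp: curves_def)
      then show ?thesis using outside_no_overlap[of ?C] by blast
    qed
    then show ?thesis by (auto simp: Eo_def)
  qed
  have Eo_out: "path_image (\<gamma> e) \<subseteq> outside ?C \<union> ?C" if "e \<in> Eo" for e
  proof -
    have "path_image (\<gamma> e) - f ` (e \<inter> \<Union>(cycle_edges cs)) \<subseteq> outside ?C"
      using edge_outside[OF F, of e] that Eo_not by (auto simp: Eo_def)
    then show ?thesis using ends_on_curves[OF F] by blast
  qed
  have Eo_sub: "e \<subseteq> set cs \<union> Vo" if e: "e \<in> Eo" for e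
  proof
    fix v assume v: "v \<in> e"
    have eE: "e \<in> E" using e by (simp add: Eo_def)
    have vV: "v \<in> V" using v eE edge_subset by blast
    have "f v \<in> outside ?C \<union> ?C" using Eo_out[OF e] ends_on_curve[OF eE] v by blast
    then show "v \<in> set cs \<union> Vo"
      using vertex_on_curves[OF F vV] vV Union_cycle_edges[OF cs0] by (auto simp: Vo_def)
  qed
  \<comment> \<open>Everything inside the cycle is discarded first, so that no vertex or curve
    passes through the centre \<open>p\<close> of the inversion.\<close>
  let ?V = "set cs \<union> Vo" and ?E = "cycle_edges cs \<union> Eo"
  have "plane_graph ?V ?E f \<gamma>"
  proof (rule plane_graph_subgraph[OF PG])
    show "?V \<subseteq> V" using csV by (auto simp: Vo_def)
    show "?E \<subseteq> E" using F by (auto simp: Eo_def)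
    show "e \<subseteq> ?V" if "e \<in> ?E" for e using that Eo_sub Union_cycle_edges[OF cs0] by blast
  qed
  moreover have pC: "p \<notin> ?C" "p \<notin> outside ?C" using p notin_inside inside_Int_outside by blast+
  moreover have csC: "f ` set cs \<subseteq> ?C" using ends_on_curves[OF F] Union_cycle_edges[OF cs0] by simp
  moreover have "p \<notin> f ` ?V" using pC csC by (auto simp: Vo_def)
  moreover have "p \<notin> curves \<gamma> ?E" using pC Eo_out by (auto simp: curves_def)
  ultimately have PG': "plane_graph ?V ?E (\<lambda>v. 1 / (f v - p)) (\<lambda>e t. 1 / (\<gamma> e t - p))"
    using plane_graph_inversion by blast
  let ?f = "\<lambda>v. 1 / (f v - p)" and ?\<gamma> = "\<lambda>e t. 1 / (\<gamma> e t - p)"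
  interpret O: plane_graph ?V ?E "\<lambda>v. 1 / (f v - p)" ?\<gamma> by (rule PG')
  have img: "curves ?\<gamma> (cycle_edges cs) = (\<lambda>z. 1 / (z - p)) ` ?C"
    by (auto simp: curves_def path_image_def)
  have CE: "is_cycle ?E cs" using dcs by (simp add: is_cycle_def)
  have VoV: "Vo \<subseteq> V" by (auto simp: Vo_def)
  have cV: "card ?V \<le> card V" using csV VoV finite_V by (intro card_mono) auto
  have "card (inner_edges ?E ?\<gamma> cs) + 3 \<le> 3 * card (inner_vertices ?V ?f ?\<gamma> cs) + length cs"
    by (rule disc_bound[OF PG' CE cV]) (rule IHM)
  moreover have "Eo \<subseteq> inner_edges ?E ?\<gamma> cs"
  proof
    fix e assume e: "e \<in> Eo"
    then obtain z where z: "z \<in> path_image (\<gamma> e)" "z \<in> outside ?C" by (auto simp: Eo_def)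
    have "1 / (z - p) \<in> path_image (?\<gamma> e)" using z(1) by (auto simp: path_image_def)
    moreover have "1 / (z - p) \<in> inside (curves ?\<gamma> (cycle_edges cs))"
      unfolding img by (rule outside_inversion[OF compactC p z(2)])
    ultimately show "e \<in> inner_edges ?E ?\<gamma> cs" using e by (auto simp: inner_edges_def)
  qed
  then have "card Eo \<le> card (inner_edges ?E ?\<gamma> cs)" using O.finite_inner by (intro card_mono)
  moreover have "inner_vertices ?V ?f ?\<gamma> cs \<subseteq> Vo"
    using O.inner_vertices_not_cycle[OF CE] by (auto simp: inner_vertices_def)
  then have "card (inner_vertices ?V ?f ?\<gamma> cs) \<le> card Vo"
    using VoV finite_V finite_subset by (intro card_mono) auto
  ultimately have out: "card Eo + 3 \<le> 3 * card Vo + length cs" by linarith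
  have inn: "card (inner_edges E \<gamma> cs) + 3 \<le> 3 * card (inner_vertices V f \<gamma> cs) + length cs"
    by (rule disc_bound[OF PG C order_refl]) (rule IHM)
  have "E \<subseteq> cycle_edges cs \<union> inner_edges E \<gamma> cs \<union> Eo"
  proof
    fix e assume e: "e \<in> E"
    show "e \<in> cycle_edges cs \<union> inner_edges E \<gamma> cs \<union> Eo"
    proof (cases "e \<in> cycle_edges cs")
      case False
      obtain z where z: "z \<in> path_image (\<gamma> e)" "z \<notin> f ` e"
        using edge_minus_ends_nonempty[OF e] by blast
      then have "z \<notin> ?C" using edge_minus_disjoint[OF F, of e] e False by blast
      then have "z \<in> inside ?C \<or> z \<in> outside ?C" using inside_Un_outside[of ?C] by blast
      then show ?thesis using z(1) e by (auto simp: inner_edges_def Eo_def)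
    qed simp
  qed
  then have "card E \<le> card (cycle_edges cs \<union> inner_edges E \<gamma> cs \<union> Eo)"
    using finite_inner finite_E by (intro card_mono) (auto simp: Eo_def)
  also have "\<dots> \<le> card (cycle_edges cs) + card (inner_edges E \<gamma> cs) + card Eo"
    by (meson add_le_mono card_Un_le le_trans order_refl)
  finally have cE: "card E \<le> length cs + card (inner_edges E \<gamma> cs) + card Eo"
    using card_cycle_edges_le[of cs] by linarith
  have d1: "inner_vertices V f \<gamma> cs \<inter> set cs = {}" by (rule inner_vertices_not_cycle[OF C])
  have d2: "Vo \<inter> set cs = {}" using csC outside_no_overlap[of ?C] unfolding Vo_def by blast
  have d3: "inner_vertices V f \<gamma> cs \<inter> Vo = {}"
    using inside_Int_outside[of ?C] unfolding Vo_def inner_vertices_def by blast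
  have "card (set cs \<union> inner_vertices V f \<gamma> cs) = length cs + card (inner_vertices V f \<gamma> cs)"
    using d1 finite_inner(2) dcs(1) by (subst card_Un_disjoint) (auto simp: distinct_card)
  moreover have "card (set cs \<union> inner_vertices V f \<gamma> cs \<union> Vo) =
      card (set cs \<union> inner_vertices V f \<gamma> cs) + card Vo"
    using d2 d3 finite_inner(2) finite_subset[OF VoV finite_V] by (intro card_Un_disjoint) auto
  ultimately have "length cs + card (inner_vertices V f \<gamma> cs) + card Vo =
      card (set cs \<union> inner_vertices V f \<gamma> cs \<union> Vo)" by simp
  also have "\<dots> \<le> card V" using csV VoV finite_V by (intro card_mono) (auto simp: inner_vertices_def)
  \<comment> \<open>With i vertices inside, o outside and k on the cycle, the edges number at most k
    + (3i+k-3) + (3o+k-3) = 3(i+o+k) - 6.\<close>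
  finally show ?thesis using cE out inn by linarith
qed

text \<open>A vertex of degree at most 1 is deleted; otherwise there is a cycle and
  \<open>cycle_bound\<close> applies. The weaker bound also covers a single vertex and is the one
  handed to the disc argument, where a component may be that small.\<close>

lemma plane_graph_edge_bound:
  assumes "plane_graph V E f \<gamma>" "V \<noteq> {}"
  shows "card E + 3 \<le> 3 * card V \<and> (2 \<le> card V \<longrightarrow> card E + 5 \<le> 3 * card V)"
  using assms
proof (induction "card V" arbitrary: V E f \<gamma> rule: less_induct)
  case less
  interpret plane_graph V E f \<gamma> by fact
  show ?case
  proof (cases "\<exists>v\<in>V. card (nbrs E v) \<le> 1")
    case False
    then have "\<exists>cs. is_cycle E cs" using min_degree_cycle[OF G less.prems(2)] by fastforce
    then obtain cs where "is_cycle E cs" by blast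
    from cycle_bound[OF this] less.hyps show ?thesis by fastforce
  next
    case True
    then obtain v where v: "v \<in> V" "card (nbrs E v) \<le> 1" by blast
    let ?E = "{e \<in> E. v \<notin> e}"
    have cV: "card V = Suc (card (V - {v}))" using card_Suc_Diff1[OF finite_V v(1)] by simp
    have cE: "card E \<le> card ?E + 1" using card_edges_delete[OF G, of v] v(2) by linarith
    have PG: "plane_graph (V - {v}) ?E f \<gamma>"
      by (rule plane_graph_subgraph[OF less.prems(1)]) (use edge_subset in auto)
    show ?thesis
    proof (cases "V - {v} = {}")
      case True
      then have "V = {v}" using v by blast
      then have "E = {}" using G by (auto simp: simple_graph_def)
      then show ?thesis using \<open>V = {v}\<close> by simp
    next
      case False
      then have "card (V - {v}) > 0" using finite_V by (simp add: card_gt_0_iff)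
      moreover have "card ?E + 3 \<le> 3 * card (V - {v}) \<and> (2 \<le> card (V - {v}) \<longrightarrow> card ?E + 5 \<le> 3 * card (V - {v}))"
        using less.hyps[OF _ PG False] cV by simp
      ultimately show ?thesis using cE cV by linarith
    qed
  qed
qed

theorem mainTheorem6:
  fixes V :: "'a set" and E :: "'a set set"
  assumes "simple_graph V E" and "planar V E" and "card V \<ge> 3"
  shows "real (inv_diam 3 V E) \<le> 11/6 * real (card V) - 8/3
       \<and> inv_diam 5 V E \<le> inv_diam 4 V E
       \<and> real (inv_diam 4 V E) \<le> 4/3 * real (card V) + 10/3"
proof -
  obtain f \<gamma> where "plane_graph V E f \<gamma>" using planar_imp_plane_graph[OF assms(1,2)] by blast
  moreover have "V \<noteq> {}" using assms(3) by auto
  ultimately have m: "card E + 5 \<le> 3 * card V" using plane_graph_edge_bound assms(3) by fastforce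
  \<comment> \<open>Here q = p - 1. For n vertices and at most 3n-5 edges this gives (7n-10)/4,
    which is at most 11n/6 - 8/3 for n \<ge> 2; the case p = 4 gives (8n-10)/6.\<close>
  have 3: "4 * inv_diam 3 V E \<le> 2 * card E + card V"
    using inv_diam_le[OF assms(1), of 2] by (simp add: numeral_eq_Suc)
  have 4: "6 * inv_diam 4 V E \<le> 2 * card E + 2 * card V"
    using inv_diam_le[OF assms(1), of 3] by (simp add: numeral_eq_Suc)
  have 5: "inv_diam 5 V E \<le> inv_diam 4 V E"
    using inv_diam_antimono[OF assms(1), of 3 5] by (simp add: numeral_eq_Suc)
  show ?thesis using m 3 4 5 assms(3) by linarith
qed

end
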